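(* Let $\gamma:\mathbb R^n\times\mathcal P_2(\mathbb R^n\times U)\times U\times Z\to\mathbb R^n$ satisfy the conditions in the context. For any $(\mu,\hat u,z)\in\mathcal P_2(\mathbb R^n)\times\hat{\mathscr U}(\mathbb R^n)\times Z$ and $\nu\in\mathcal P_2(\mathbb R^n)$, one has $I^{\mu,\hat u,z,*}(\nu)\in\mathcal P_2(\mathbb R^n)$. Moreover, let $(X,\alpha)$ be an $\mathbb R^n\times U$-valued random variable, with $X$ square-integrable, on a probability space $(\Omega,\mathcal F,\mathbb P)$ and $\mathcal G\subset\mathcal F$ a sub-$\sigma$-algebra; set $\rho:=\mathcal L((X,\alpha)|\mathcal G)$, $\mu:=\mathcal L(X|\mathcal G)$ and $\hat\alpha(x)(du):=\mathcal L(\alpha|\mathcal G,X=x)(du)$. Then, $\mathbb P$-a.s., $$I^{\mu,\hat\alpha,z,*}\mu=\mathcal L\big(X+\gamma(X,\rho,\alpha,z)\,\big|\,\mathcal G\big),$$ where $I^{\mu,\hat\alpha,z,*}\mu(\omega)$ means $I^{\mu(\omega),\hat\alpha(\omega),z,*}(\mu(\omega))$.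
   Context: $(B,\|\cdot\|)$ is a Banach space, $U\subset B$ compact, $(Z,\mathscr Z)$ a measurable space. $\mathcal P_2(E)$: Borel probability measures on $E$ with finite second moment. $\mathcal P_2(\mathbb R^n\times U)$ has the metric induced by $\|\rho\|_{K,\rm FM}=\sup\{\int f\,d\rho:f:\mathbb R^n\times B\to\mathbb R\text{ 1-Lipschitz},\|f\|_\infty\le1\}$ ($\mathbb R^n\times B$ with norm $|x|+\|u\|$). Conditions on $\gamma$ (part of the paper's standing assumptions): $\gamma$ is continuous (in particular measurable), $|\gamma(x',\rho',u,z)-\gamma(x,\rho,u,z)|\le L(|x-x'|+\|\rho-\rho'\|_{K,\rm FM})$ and $|\gamma(x,\rho,u,z)|\le L(1+|x|+M_2(\rho))$ with $M_2(\rho)=(\int(|x|^2+\|u\|^2)d\rho)^{1/2}$ and $L$ independent of $(u,z)$. $\hat{\mathscr U}(\mathbb R^n)$: probability kernels $\hat u(x,du)=\hat u(x)(du)$ from $\mathbb R^n$ to $U$; $(\mu\cdot\hat u)(dx,du)=\mu(dx)\hat u(x,du)$. For $\varphi\in C_b(\mathbb R^n)$, $$I^{\mu,\hat u,z}(\varphi)(x)=\int_U\varphi\big(x+\gamma(x,\mu\cdot\hat u,u,z)\big)\hat u(x,du),$$ and $I^{\mu,\hat u,z,*}$ is the adjoint operator, characterized on probability measures by $\langle\varphi,I^{\mu,\hat u,z,*}\nu\rangle=\langle I^{\mu,\hat u,z}(\varphi),\nu\rangle$ for all $\varphi\in C_b(\mathbb R^n)$, where $\langle\varphi,\nu\rangle=\int\varphi\,d\nu$.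 $\mathcal L(\cdot|\cdot)$ denotes regular conditional law. *)

theory Defs
  imports "HOL-Probability.Probability"
begin

text \<open>
  A Borel measure on a subset \<open>E\<close> of a normed space lives on the Borel subspace
  \<open>restrict_space borel E\<close>.  For \<open>E = UNIV \<times> U\<close> the squared product norm
  integrated below is \<open>|x|\<^sup>2 + \<parallel>u\<parallel>\<^sup>2\<close> (lemma \<open>norm_Pair\<close>).
\<close>

definition P2 :: "'a::real_normed_vector set \<Rightarrow> 'a measure set" where
  "P2 E = {\<rho>. prob_space \<rho> \<and> sets \<rho> = sets (restrict_space borel E) \<and>
              integrable \<rho> (\<lambda>p. (norm p)\<^sup>2)}"

definition M2 :: "('a::real_normed_vector \<times> 'b::real_normed_vector) measure \<Rightarrow> real" where
  "M2 \<rho> = sqrt (\<integral>(x, u). (norm x)\<^sup>2 + (norm u)\<^sup>2 \<partial>\<rho>)"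

text \<open>
  Lipschitz continuity refers to the norm \<open>|x| + \<parallel>u\<parallel>\<close>, not to the Euclidean product
  norm of the product type.
\<close>

definition FM_test :: "('a::real_normed_vector \<times> 'b::real_normed_vector \<Rightarrow> real) set" where
  "FM_test = {f. (\<forall>x u y v. \<bar>f (x, u) - f (y, v)\<bar> \<le> norm (x - y) + norm (u - v)) \<and>
                 (\<forall>p. \<bar>f p\<bar> \<le> 1)}"

text \<open>
  The distance \<open>\<parallel>\<rho> - \<rho>'\<parallel>\<close> in the Fortet--Mourier norm; the value outside \<open>P2\<close>, where the
  supremum may be infinite, is a dummy required by the total axioms of \<^locale>\<open>Metric_space\<close>.
\<close>

definition FM_dist :: "'b::real_normed_vector set \<Rightarrow>
    ('a::real_normed_vector \<times> 'b) measure \<Rightarrow> ('a \<times> 'b) measure \<Rightarrow> real" where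
  "FM_dist U \<rho> \<rho>' =
     (if \<rho> \<in> P2 (UNIV \<times> U) \<and> \<rho>' \<in> P2 (UNIV \<times> U)
      then (SUP f\<in>FM_test. (\<integral>p. f p \<partial>\<rho>) - (\<integral>p. f p \<partial>\<rho>')) else 0)"

lemma FM_test_cont: assumes "f \<in> FM_test" 
  shows "continuous_on UNIV (f :: ('a::real_normed_vector \<times> 'b::real_normed_vector) \<Rightarrow> real)"
proof -
  have "dist (f p) (f q) \<le> 2 * dist p q" for p q
  proof -
    obtain x u y v where pq: "p = (x,u)" "q = (y,v)" by (metis surj_pair)
    have "dist (f p) (f q) \<le> norm (x - y) + norm (u - v)"
      using assms by (auto simp: FM_test_def pq dist_real_def)
    also have "norm (x - y) \<le> dist p q" using dist_fst_le[of p q] by (simp add: pq dist_norm)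
    also have "norm (u - v) \<le> dist p q" using dist_snd_le[of p q] by (simp add: pq dist_norm)
    finally show ?thesis by simp
  qed
  then have "2-lipschitz_on UNIV f" by (intro lipschitz_onI) auto
  then show ?thesis by (rule lipschitz_on_continuous_on)
qed

lemma FM_test_integral: assumes f: "f \<in> FM_test" and \<rho>: "\<rho> \<in> P2 (UNIV \<times> (U :: 'b::real_normed_vector set))"
  shows "integrable \<rho> f" "\<bar>\<integral>p. f p \<partial>\<rho>\<bar> \<le> 1"
proof -
  interpret prob_space \<rho> using \<rho> by (simp add: P2_def)
  have m: "f \<in> borel_measurable \<rho>"
    using borel_measurable_continuous_onI[OF FM_test_cont[OF f]] \<rho>
    by (auto simp: P2_def intro: measurable_restrict_space1 cong: measurable_cong_sets)
  have b: "\<bar>f p\<bar> \<le> 1" for p using f unfolding FM_test_def by blast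
  show i: "integrable \<rho> f" by (rule integrable_const_bound[of _ 1]) (auto simp: b m)
  have "\<bar>\<integral>p. f p \<partial>\<rho>\<bar> \<le> (\<integral>p. \<bar>f p\<bar> \<partial>\<rho>)" by (rule integral_abs_bound)
  also have "\<dots> \<le> (\<integral>p. 1 \<partial>\<rho>)" by (rule integral_mono) (auto simp: b i)
  finally show "\<bar>\<integral>p. f p \<partial>\<rho>\<bar> \<le> 1" by (simp add: prob_space)
qed

lemma FM_test_separates:
  fixes \<rho> \<rho>' :: "('a::real_normed_vector \<times> 'b::real_normed_vector) measure"
  assumes \<rho>: "\<rho> \<in> P2 (UNIV \<times> U)" "\<rho>' \<in> P2 (UNIV \<times> U)"
   and eq: "\<And>f. f \<in> FM_test \<Longrightarrow> (\<integral>p. f p \<partial>\<rho>) = (\<integral>p. f p \<partial>\<rho>')"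
  shows "\<rho> = \<rho>'"
proof -
  let ?W = "(UNIV :: 'a set) \<times> U"
  interpret p1: prob_space \<rho> using \<rho> by (simp add: P2_def)
  interpret p2: prob_space \<rho>' using \<rho> by (simp add: P2_def)
  have s: "sets \<rho> = sets (restrict_space borel ?W)" "sets \<rho>' = sets (restrict_space borel ?W)"
    using \<rho> by (auto simp: P2_def)
  have sp: "space \<rho> = ?W" "space \<rho>' = ?W" using s[THEN sets_eq_imp_space_eq] by (auto simp: space_restrict_space)
  have closed_eq: "measure \<rho> (C \<inter> ?W) = measure \<rho>' (C \<inter> ?W)" if C: "closed C" "C \<noteq> {}" for C
  proof -
    define g where "g k p = max 0 (1 - (real k + 1) * infdist p C)" for k and p :: "'a \<times> 'b"
    have t: "(\<lambda>p. g k p / (real k + 1)) \<in> FM_test" for k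
    proof -
      have "\<bar>g k (x,u) / (real k + 1) - g k (y,v) / (real k + 1)\<bar> \<le> norm (x-y) + norm (u-v)" for x u y v
      proof -
        have "\<bar>g k (x,u) / (real k + 1) - g k (y,v) / (real k + 1)\<bar> = \<bar>g k (x,u) - g k (y,v)\<bar> / (real k + 1)"
          by (simp add: diff_divide_distrib[symmetric])
        also have "\<bar>g k (x,u) - g k (y,v)\<bar> \<le> \<bar>(1 - (real k + 1) * infdist (x,u) C) - (1 - (real k + 1) * infdist (y,v) C)\<bar>"
          unfolding g_def by linarith
        also have "\<dots> = (real k + 1) * \<bar>infdist (x,u) C - infdist (y,v) C\<bar>"
        proof -
          have "(1 - (real k + 1) * infdist (x,u) C) - (1 - (real k + 1) * infdist (y,v) C) = (real k + 1) * (infdist (y,v) C - infdist (x,u) C)"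
            by (simp add: algebra_simps)
          then show ?thesis by (simp add: abs_mult abs_minus_commute)
        qed
        finally have "\<bar>g k (x,u) / (real k + 1) - g k (y,v) / (real k + 1)\<bar> \<le> \<bar>infdist (x,u) C - infdist (y,v) C\<bar>"
          by (simp add: divide_simps mult.commute add.commute split: if_splits)
        also have "\<dots> \<le> dist (x,u) (y,v)" using infdist_triangle_abs by blast
        also have "\<dots> \<le> norm (x-y) + norm (u-v)"
          by (simp add: dist_norm norm_Pair_le)
        finally show ?thesis .
      qed
      moreover have "\<bar>g k p / (real k + 1)\<bar> \<le> 1" for p
      proof -
        have "0 \<le> g k p" "g k p \<le> 1" by (auto simp: g_def infdist_nonneg)
        then show ?thesis by (simp add: divide_simps)
      qed
      ultimately show ?thesis unfolding FM_test_def by blast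
    qed
    have ge: "(\<integral>p. g k p \<partial>\<rho>) = (\<integral>p. g k p \<partial>\<rho>')" for k
      using eq[OF t[of k]] by simp
    have lim: "(\<lambda>k. g k p) \<longlonglongrightarrow> indicator C p" for p
    proof (cases "p \<in> C")
      case True then show ?thesis by (simp add: g_def)
    next
      case False
      then have pos: "infdist p C > 0" using C by (metis in_closed_iff_infdist_zero infdist_nonneg less_eq_real_def)
      have "eventually (\<lambda>k. g k p = 0) sequentially"
      proof -
        obtain K where K: "real K > 1 / infdist p C" using reals_Archimedean2 by blast
        have "g k p = 0" if "k \<ge> K" for k
        proof -
          have "1 / infdist p C \<le> real k + 1" using K that by linarith
          then have "1 \<le> (real k + 1) * infdist p C" using pos by (simp add: divide_simps split: if_splits)
          then show ?thesis by (simp add: g_def)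
        qed
        then show ?thesis by (auto simp: eventually_sequentially)
      qed
      then show ?thesis using False by (simp add: tendsto_eventually)
    qed
    have L: "(\<lambda>k. \<integral>p. g k p \<partial>q) \<longlonglongrightarrow> measure q (C \<inter> ?W)" if q: "q \<in> P2 ?W" for q
    proof -
      interpret prob_space q using q by (simp add: P2_def)
      have sq: "sets q = sets (restrict_space borel ?W)" using q by (simp add: P2_def)
      have sp: "space q = ?W" using sets_eq_imp_space_eq[OF sq] by (simp add: space_restrict_space)
      have "C \<inter> ?W \<in> sets q" using C(1) sq by (auto simp: sets_restrict_space)
      then have "(\<integral>p. indicator C p \<partial>q) = measure q (C \<inter> ?W)"
        by (subst Bochner_Integration.integral_cong[OF refl, of _ _ "indicator (C \<inter> ?W) :: _ \<Rightarrow> real"]) (auto simp: sp indicator_def)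
      moreover have "(\<lambda>k. \<integral>p. g k p \<partial>q) \<longlonglongrightarrow> (\<integral>p. indicator C p \<partial>q)"
      proof (rule integral_dominated_convergence[where w="\<lambda>_. 1"])
        have mb: "indicator C \<in> borel_measurable (borel :: ('a \<times> 'b) measure)" using C by auto
        show "indicator C \<in> borel_measurable q"
          using measurable_restrict_space1[OF mb, of ?W] sq by (simp cong: measurable_cong_sets)
        show "g k \<in> borel_measurable q" for k
        proof -
          have "(\<lambda>p. (real k + 1) * (g k p / (real k + 1))) \<in> borel_measurable q"
            using borel_measurable_integrable[OF FM_test_integral(1)[OF t[of k] q]] by measurable
          then show ?thesis by simp
        qed
        show "AE p in q. (\<lambda>k. g k p) \<longlonglongrightarrow> indicator C p" by (simp add: lim)
      qed (auto simp: g_def infdist_nonneg)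
      ultimately show ?thesis by simp
    qed
    show ?thesis using LIMSEQ_unique[OF L[OF \<rho>(1)]] L[OF \<rho>(2)] ge by simp
  qed
  let ?E = "(\<inter>) ?W ` Collect closed"
  show ?thesis
  proof (rule measure_eqI_generator_eq[of ?E ?W _ _ "\<lambda>_. ?W"])
    show "Int_stable ?E"
    proof (rule Int_stableI)
      fix A B assume A: "A \<in> ?E" and B: "B \<in> ?E"
      from A obtain C where C: "A = ?W \<inter> C" "closed C" by (elim imageE CollectE)
      from B obtain D where D: "B = ?W \<inter> D" "closed D" by (elim imageE CollectE)
      have "A \<inter> B = ?W \<inter> (C \<inter> D)" "C \<inter> D \<in> Collect closed"
        using C D by (simp_all add: closed_Int Int_ac)
      then show "A \<inter> B \<in> ?E" by (rule image_eqI)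
    qed
    show "emeasure \<rho> X = emeasure \<rho>' X" if X: "X \<in> ?E" for X
    proof -
      from X obtain C where C: "X = C \<inter> ?W" "closed C" by (elim imageE CollectE) (simp add: Int_commute)
      show ?thesis
        using C closed_eq[of C]
        by (cases "C = {}") (simp_all add: p1.emeasure_eq_measure p2.emeasure_eq_measure)
    qed
    have "sets (restrict_space borel ?W) = (\<inter>) ?W ` sigma_sets UNIV (Collect closed)"
      unfolding sets_restrict_space by (subst borel_eq_closed) simp
    also have "\<dots> = sigma_sets ?W ?E"
    proof -
      have "(\<inter>) ?W ` N = {id -` A \<inter> ?W |A. A \<in> N}" for N by (auto simp: image_def)
      then show ?thesis using sigma_sets_vimage_commute[of id ?W UNIV "Collect closed"] by simp
    qed
    finally show "sets \<rho> = sigma_sets ?W ?E" "sets \<rho>' = sigma_sets ?W ?E" using s by simp_all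
    show "?E \<subseteq> Pow ?W" by (rule image_subsetI) simp
    have "?W \<in> ?E" by (rule image_eqI[of _ _ UNIV]) simp_all
    then show "range (\<lambda>_. ?W) \<subseteq> ?E" by (simp only: image_constant_conv) simp
    show "(\<Union>i :: nat. ?W) = ?W" by simp
    show "emeasure \<rho> ?W \<noteq> \<infinity>" for i :: nat by simp
  qed
qed

lemma Metric_space_FM_dist:
  "Metric_space (P2 (UNIV \<times> U)) (FM_dist U :: ('a::real_normed_vector \<times> 'b::real_normed_vector) measure \<Rightarrow> _)"
proof
  let ?W = "(UNIV :: 'a set) \<times> U"
  let ?d = "FM_dist U :: ('a \<times> 'b) measure \<Rightarrow> _"
  have z: "(\<lambda>_. 0) \<in> (FM_test :: ('a \<times> 'b \<Rightarrow> real) set)" by (auto simp: FM_test_def)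
  have m: "(\<lambda>p. - f p) \<in> FM_test" if "f \<in> FM_test" for f :: "'a \<times> 'b \<Rightarrow> real"
    using that unfolding FM_test_def by (auto simp: abs_minus_commute)
  have bd: "bdd_above ((\<lambda>f. (\<integral>p. f p \<partial>r) - (\<integral>p. f p \<partial>s)) ` FM_test)" if "r \<in> P2 ?W" "s \<in> P2 ?W" for r s
    using FM_test_integral(2)[OF _ that(1)] FM_test_integral(2)[OF _ that(2)] by (intro bdd_aboveI2[of _ _ 2]) (smt (verit))
  have up: "(\<integral>p. f p \<partial>r) - (\<integral>p. f p \<partial>s) \<le> ?d r s" if "r \<in> P2 ?W" "s \<in> P2 ?W" "f \<in> FM_test" for r s f
    using cSUP_upper[OF that(3) bd[OF that(1,2)]] that by (simp add: FM_dist_def)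
  show nn: "0 \<le> ?d r s" for r s
    using up[OF _ _ z, of r s] by (cases "r \<in> P2 ?W \<and> s \<in> P2 ?W") (auto simp: FM_dist_def)
  have le: "?d r s \<le> c" if "r \<in> P2 ?W" "s \<in> P2 ?W" "\<And>f. f \<in> FM_test \<Longrightarrow> (\<integral>p. f p \<partial>r) - (\<integral>p. f p \<partial>s) \<le> c" for r s c
    using cSUP_least[of FM_test "\<lambda>f. (\<integral>p. f p \<partial>r) - (\<integral>p. f p \<partial>s)" c] that z by (auto simp: FM_dist_def)
  have c1: "?d r s \<le> ?d s r" if "r \<in> P2 ?W" "s \<in> P2 ?W" for r s
    by (rule le[OF that]) (use up[OF that(2,1) m] in simp)
  show "?d r s = ?d s r" for r s
    using c1[of r s] c1[of s r] by (cases "r \<in> P2 ?W \<and> s \<in> P2 ?W") (auto simp: FM_dist_def)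
  show "?d r s = 0 \<longleftrightarrow> r = s" if rs: "r \<in> P2 ?W" "s \<in> P2 ?W" for r s
  proof
    assume 0: "?d r s = 0"
    show "r = s" by (rule FM_test_separates[OF rs]) (use 0 up[OF rs] up[OF rs m] in fastforce)
  qed (use le[of r s 0] nn[of r s] rs in auto)
  show "?d r t \<le> ?d r s + ?d s t" if "r \<in> P2 ?W" "s \<in> P2 ?W" "t \<in> P2 ?W" for r s t
    by (rule le[OF that(1,3)]) (use up[OF that(1,2)] up[OF that(2,3)] in fastforce)
qed

definition P2_topology :: "'b::real_normed_vector set \<Rightarrow>
    ('a::real_normed_vector \<times> 'b) measure topology" where
  "P2_topology U = Metric_space.mtopology (P2 (UNIV \<times> U)) (FM_dist U)"

definition P2_borel :: "'b::real_normed_vector set \<Rightarrow>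
    ('a::real_normed_vector \<times> 'b) measure measure" where
  "P2_borel U = sigma (P2 (UNIV \<times> U)) {S. openin (P2_topology U) S}"

definition kernels :: "'b::real_normed_vector set \<Rightarrow>
    ('a::real_normed_vector \<Rightarrow> 'b measure) set" where
  "kernels U = borel \<rightarrow>\<^sub>M prob_algebra (restrict_space borel U)"

definition kernel_prod :: "'b::real_normed_vector set \<Rightarrow>
    'a::real_normed_vector measure \<Rightarrow> ('a \<Rightarrow> 'b measure) \<Rightarrow> ('a \<times> 'b) measure" where
  "kernel_prod U \<mu> k =
     \<mu> \<bind> (\<lambda>x. distr (k x) (restrict_space borel (UNIV \<times> U)) (\<lambda>u. (x, u)))"

definition I_op :: "('a::real_normed_vector \<Rightarrow> ('a \<times> 'b) measure \<Rightarrow> 'b \<Rightarrow> 'z \<Rightarrow> 'a) \<Rightarrow>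
    'b::real_normed_vector set \<Rightarrow> 'a measure \<Rightarrow> ('a \<Rightarrow> 'b measure) \<Rightarrow> 'z \<Rightarrow>
    ('a \<Rightarrow> real) \<Rightarrow> 'a \<Rightarrow> real" where
  "I_op \<gamma> U \<mu> k z \<phi> x = (\<integral>u. \<phi> (x + \<gamma> x (kernel_prod U \<mu> k) u z) \<partial>k x)"

text \<open>
  The adjoint of an operator on bounded continuous functions, evaluated at a probability
  measure \<open>\<nu>\<close>: the Borel probability measure \<open>\<nu>'\<close> determined by
  \<open>\<langle>\<phi>, \<nu>'\<rangle> = \<langle>T \<phi>, \<nu>\<rangle>\<close>.
\<close>

definition adjoint_meas :: "(('a::real_normed_vector \<Rightarrow> real) \<Rightarrow> 'a \<Rightarrow> real) \<Rightarrow>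
    'a measure \<Rightarrow> 'a measure" where
  "adjoint_meas T \<nu> =
     (THE \<nu>'. prob_space \<nu>' \<and> sets \<nu>' = sets borel \<and>
        (\<forall>\<phi>\<in>bcontfun. (\<integral>x. \<phi> x \<partial>\<nu>') = (\<integral>x. T \<phi> x \<partial>\<nu>)))"

definition I_adj :: "('a::real_normed_vector \<Rightarrow> ('a \<times> 'b) measure \<Rightarrow> 'b \<Rightarrow> 'z \<Rightarrow> 'a) \<Rightarrow>
    'b::real_normed_vector set \<Rightarrow> 'a measure \<Rightarrow> ('a \<Rightarrow> 'b measure) \<Rightarrow> 'z \<Rightarrow>
    'a measure \<Rightarrow> 'a measure" where
  "I_adj \<gamma> U \<mu> k z \<nu> = adjoint_meas (I_op \<gamma> U \<mu> k z) \<nu>"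

text \<open>
  \<open>\<kappa>\<close> is a version of the regular conditional law of the \<open>N\<close>-valued random variable \<open>Y\<close>
  given the sub-\<open>\<sigma>\<close>-algebra \<open>G\<close> of the probability space \<open>M\<close>.
\<close>

definition reg_cond_law :: "'w measure \<Rightarrow> 'w measure \<Rightarrow> 'c measure \<Rightarrow> ('w \<Rightarrow> 'c) \<Rightarrow>
    ('w \<Rightarrow> 'c measure) \<Rightarrow> bool" where
  "reg_cond_law M G N Y \<kappa> \<longleftrightarrow>
     Y \<in> M \<rightarrow>\<^sub>M N \<and> \<kappa> \<in> G \<rightarrow>\<^sub>M prob_algebra N \<and>
     (\<forall>A\<in>sets N. AE \<omega> in M.
        measure (\<kappa> \<omega>) A = real_cond_exp M G (\<lambda>\<omega>'. indicator A (Y \<omega>')) \<omega>)"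

definition sigma_join :: "'w measure \<Rightarrow> ('w \<Rightarrow> 'a::topological_space) \<Rightarrow> 'w measure" where
  "sigma_join G X = sigma (space G) (sets G \<union> {X -` A \<inter> space G | A. A \<in> sets borel})"

text \<open>
  \<open>a \<omega> x\<close> is a version of the conditional law of \<open>Y\<close> given \<open>G\<close> and \<open>X = x\<close>: a kernel in
  \<open>(\<omega>, x)\<close> which yields the regular conditional law of \<open>Y\<close> given the \<open>\<sigma>\<close>-algebra generated
  by \<open>G\<close> and \<open>X\<close> upon inserting \<open>x = X \<omega>\<close>.
\<close>

definition reg_cond_law_at :: "'w measure \<Rightarrow> 'w measure \<Rightarrow> ('w \<Rightarrow> 'a::topological_space) \<Rightarrow>
    'c measure \<Rightarrow> ('w \<Rightarrow> 'c) \<Rightarrow> ('w \<Rightarrow> 'a \<Rightarrow> 'c measure) \<Rightarrow> bool" where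
  "reg_cond_law_at M G X N Y a \<longleftrightarrow>
     (\<lambda>(\<omega>, x). a \<omega> x) \<in> G \<Otimes>\<^sub>M borel \<rightarrow>\<^sub>M prob_algebra N \<and>
     reg_cond_law M (sigma_join G X) N Y (\<lambda>\<omega>. a \<omega> (X \<omega>))"

end

theory Submission
  imports Defs
begin

text \<open>
  The adjoint measure is the image of \<open>\<nu> \<cdot> k\<close> under \<open>(x, u) \<mapsto> x + \<gamma> x \<pi> u z\<close> with
  \<open>\<pi> = \<mu> \<cdot> k\<close>, so its second moment is finite by linear growth.  For the conditional
  statement, conditioning first on \<open>G\<close> and \<open>X\<close>, then on \<open>G\<close>, shows that
  \<open>\<mu> \<omega> \<cdot> a \<omega>\<close> is a version of the conditional law \<open>\<rho>\<close> of \<open>(X, \<alpha>)\<close>, hence equal to it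
  almost surely.  Freezing the \<open>G\<close>-measurable parameter \<open>\<rho>\<close> identifies the conditional law of
  \<open>X + \<gamma> X \<rho> \<alpha> z\<close> with the image of \<open>\<rho> \<omega>\<close> under \<open>(x, u) \<mapsto> x + \<gamma> x (\<rho> \<omega>) u z\<close>.  The delicate
  point is the joint measurability of this map in \<open>(\<omega>, x, u)\<close>, which is obtained by
  approximating \<open>\<rho>\<close> in the Fortet--Mourier distance.
\<close>

section \<open>Borel sets of the product with a compact set\<close>

text \<open>Two sigma-algebras on laws meet here. That \<open>\<rho>\<close> is a kernel says that
  its evaluations on Borel sets are measurable, while the measurability of \<open>\<gamma>\<close>
  in the law refers to the Borel sets of the Fortet--Mourier metric. The two are never compared:
  \<open>\<gamma>\<close> is used at one frozen law at a time, and the Lipschitz bound, uniform in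
  \<open>(x, u)\<close>, carries measurability along maps with countably many values. The Banach
  space may be non-separable, so countability has to come from R^n and the compact \<open>U\<close>.
  They give a dense sequence of the product set, which serves twice: its balls yield a countable
  pi-system, on which almost sure equality of measures can be tested, and its points support the
  approximating laws. The adjoint is a definite description, so identifying it takes the duality and
  a uniqueness argument. The duality is checked by integration alone, since a merely measurable
  kernel may let \<open>I_op\<close> send a continuous function to a discontinuous one.\<close>

lemma sets_restrict_borel_UNIV_Times:
  "sets (restrict_space borel (UNIV \<times> U)) =
   sets ((borel :: 'a::second_countable_topology measure) \<Otimes>\<^sub>M restrict_space (borel :: 'b::topological_space measure) U)"
proof (rule subset_antisym)
  show "sets ((borel :: 'a measure) \<Otimes>\<^sub>M restrict_space (borel :: 'b measure) U) \<subseteq>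
    sets (restrict_space borel (UNIV \<times> U))"
  proof -
    have "A \<times> (B \<inter> U) \<in> sets (restrict_space borel (UNIV \<times> U))"
      if "A \<in> sets (borel :: 'a measure)" "B \<in> sets (borel :: 'b measure)" for A B
    proof -
      have "fst -` A \<inter> space borel \<in> sets (borel :: ('a \<times> 'b) measure)"
        by (rule measurable_sets[OF _ that(1)]) (intro borel_measurable_continuous_onI continuous_intros)
      moreover have "snd -` B \<inter> space borel \<in> sets (borel :: ('a \<times> 'b) measure)"
        by (rule measurable_sets[OF _ that(2)]) (intro borel_measurable_continuous_onI continuous_intros)
      ultimately have "(fst -` A \<inter> space borel) \<inter> (snd -` B \<inter> space borel) \<in> sets (borel :: ('a \<times> 'b) measure)"
        by (rule sets.Int)
      moreover have "A \<times> (B \<inter> U) = (UNIV \<times> U) \<inter> ((fst -` A \<inter> space borel) \<inter> (snd -` B \<inter> space borel))"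
        by auto
      ultimately show ?thesis unfolding sets_restrict_space by (rule rev_image_eqI)
    qed
    moreover have "space (borel :: 'a measure) \<times> space (restrict_space (borel :: 'b measure) U)
        = space (restrict_space borel (UNIV \<times> U))"
      by (simp add: space_restrict_space)
    ultimately show ?thesis
      unfolding sets_pair_measure
      by (simp only:) (rule sets.sigma_sets_subset, auto simp: sets_restrict_space[of _ U] Int_commute)
  qed
  show "sets (restrict_space borel (UNIV \<times> U)) \<subseteq>
    sets ((borel :: 'a measure) \<Otimes>\<^sub>M restrict_space (borel :: 'b measure) U)"
  proof -
    have op: "(UNIV \<times> U) \<inter> W \<in> sets ((borel :: 'a measure) \<Otimes>\<^sub>M restrict_space (borel :: 'b measure) U)"
      if W: "open W" for W :: "('a \<times> 'b) set"
    proof -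
      obtain \<B> :: "'a set set" where \<B>: "countable \<B>" "topological_basis \<B>"
        using ex_countable_basis by blast
      \<comment> \<open>The type \<open>'b\<close> need not be second countable, so only the first
        side of the boxes ranges over a countable basis. For each basis set \<open>B\<close> the
        other side is the largest open set whose product with \<open>B\<close> lies in
        \<open>W\<close>, which keeps the union countable.\<close>
      define V where "V B = \<Union>{V. open V \<and> B \<times> V \<subseteq> W}" for B
      have Vop: "open (V B)" for B by (auto simp: V_def)
      have eq: "(UNIV \<times> U) \<inter> W = (\<Union>B\<in>\<B>. B \<times> (U \<inter> V B))"
      proof (intro subset_antisym subsetI)
        fix p assume p: "p \<in> (UNIV \<times> U) \<inter> W"
        obtain x u where [simp]: "p = (x, u)" by (cases p)
        have "(x, u) \<in> W" using p by simp
        then obtain A C where "open A" "open C" "(x, u) \<in> A \<times> C" "A \<times> C \<subseteq> W"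
          by (rule open_prod_elim[OF W])
        moreover from this obtain B where "B \<in> \<B>" "x \<in> B" "B \<subseteq> A"
          using topological_basisE[OF \<B>(2), of A x] by auto
        ultimately have "u \<in> V B" unfolding V_def by blast
        then show "p \<in> (\<Union>B\<in>\<B>. B \<times> (U \<inter> V B))" using p \<open>B \<in> \<B>\<close> \<open>x \<in> B\<close> by auto
      next
        fix p assume "p \<in> (\<Union>B\<in>\<B>. B \<times> (U \<inter> V B))"
        then show "p \<in> (UNIV \<times> U) \<inter> W" unfolding V_def by auto
      qed
      show ?thesis unfolding eq
      proof (rule sets.countable_UN'[OF \<B>(1)], rule image_subsetI, rule pair_measureI)
        fix B assume "B \<in> \<B>"
        then show "B \<in> sets (borel :: 'a measure)" using topological_basis_open[OF \<B>(2)] by simp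
        show "U \<inter> V B \<in> sets (restrict_space borel U)"
          unfolding sets_restrict_space using Vop[of B] by auto
      qed
    qed
    have "(\<lambda>p. p) \<in> (borel :: 'a measure) \<Otimes>\<^sub>M restrict_space (borel :: 'b measure) U \<rightarrow>\<^sub>M (borel :: ('a\<times>'b) measure)"
    proof (rule borel_measurableI)
      fix S :: "('a \<times> 'b) set" assume "open S"
      then show "(\<lambda>p. p) -` S \<inter> space ((borel :: 'a measure) \<Otimes>\<^sub>M restrict_space (borel :: 'b measure) U) \<in>
          sets ((borel :: 'a measure) \<Otimes>\<^sub>M restrict_space (borel :: 'b measure) U)"
        using op[of S] by (simp add: space_pair_measure space_restrict_space Int_commute)
    qed
    then have id: "(\<lambda>p. p) \<in> (borel :: 'a measure) \<Otimes>\<^sub>M restrict_space (borel :: 'b measure) U \<rightarrow>\<^sub>M restrict_space borel (UNIV \<times> U)"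
      by (rule measurable_restrict_space2[rotated]) (simp add: space_pair_measure space_restrict_space)
    show ?thesis
    proof
      fix A :: "('a \<times> 'b) set" assume A: "A \<in> sets (restrict_space borel (UNIV \<times> U))"
      have "A \<subseteq> UNIV \<times> U" using sets.sets_into_space[OF A] by (simp add: space_restrict_space)
      then have "(\<lambda>p. p) -` A \<inter> space ((borel :: 'a measure) \<Otimes>\<^sub>M restrict_space (borel :: 'b measure) U) = A"
        by (auto simp: space_pair_measure space_restrict_space)
      then show "A \<in> sets ((borel :: 'a measure) \<Otimes>\<^sub>M restrict_space (borel :: 'b measure) U)"
        using measurable_sets[OF id A] by simp
    qed
  qed
qed

text \<open>Compactness replaces separability of the ambient space: finite nets of \<open>U\<close>
  at the radii 1/(k+1) together form a countable dense subset of \<open>U\<close>.\<close>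

lemma countable_dense_UNIV_Times_compact:
  fixes U :: "'b::metric_space set"
  assumes "compact U" "U \<noteq> {}"
  obtains s :: "nat \<Rightarrow> 'a::{second_countable_topology,metric_space} \<times> 'b"
  where "range s \<subseteq> UNIV \<times> U" "\<And>w e. w \<in> UNIV \<times> U \<Longrightarrow> e > 0 \<Longrightarrow> \<exists>i. dist w (s i) < e"
proof -
  obtain D :: "'a set" where D: "countable D" "\<And>X. open X \<Longrightarrow> X \<noteq> {} \<Longrightarrow> \<exists>d\<in>D. d \<in> X"
    using countable_dense_setE by blast
  have "\<exists>K. finite K \<and> K \<subseteq> U \<and> U \<subseteq> (\<Union>x\<in>K. ball x (inverse (real (Suc k))))" for k
    by (rule seq_compact_imp_totally_bounded[OF compact_imp_seq_compact[OF \<open>compact U\<close>], rule_format]) simp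
  then obtain K where K: "\<And>k. finite (K k)" "\<And>k. K k \<subseteq> U"
     "\<And>k. U \<subseteq> (\<Union>x\<in>K k. ball x (inverse (real (Suc k))))" by metis
  define C where "C = D \<times> (\<Union>k. K k)"
  have cC: "countable C" unfolding C_def using D K by (intro countable_SIGMA countable_UN) (auto intro: countable_finite)
  obtain d where "d \<in> D" using D(2)[of UNIV] by auto
  obtain u where "u \<in> U" using assms by auto
  then have "\<exists>v\<in>K 0. True" using K(3)[of 0] by blast
  \<comment> \<open>Nonemptiness keeps all terms of \<open>from_nat_into C\<close> in
    \<open>C\<close>; on the empty set that enumeration is unspecified.\<close>
  then have neC: "C \<noteq> {}" using \<open>d \<in> D\<close> unfolding C_def by auto
  show thesis
  proof
    show "range (from_nat_into C) \<subseteq> UNIV \<times> U"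
      using range_from_nat_into[OF neC cC] K(2) by (auto simp: C_def)
    show "\<exists>i. dist w (from_nat_into C i) < e" if "w \<in> UNIV \<times> U" "e > 0" for w and e :: real
    proof -
      obtain x u where w0: "w = (x, u)" by fastforce
      have w: "w = (x, u)" "u \<in> U" using that(1) w0 by simp_all
      obtain d where d: "d \<in> D" "d \<in> ball x (e/2)" using D(2)[of "ball x (e/2)"] \<open>e > 0\<close> by auto
      obtain k where k: "inverse (real (Suc k)) < e/2" using reals_Archimedean[of "e/2"] \<open>e > 0\<close> by auto
      obtain v where v: "v \<in> K k" "u \<in> ball v (inverse (real (Suc k)))" using K(3)[of k] w by auto
      have "dist (x,u) (d,v) \<le> dist x d + dist u v" 
        unfolding dist_Pair_Pair by (rule sqrt_sum_squares_le_sum) auto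
      also have "\<dots> < e" using d v k by (auto simp: dist_commute)
      finally have "dist w (d, v) < e" using w by simp
      moreover have "(d, v) \<in> C" using d v by (auto simp: C_def)
      ultimately show ?thesis by (metis from_nat_into_surj[OF cC])
    qed
  qed
qed

text \<open>A countable pi-system lets almost sure equalities, one for each set, merge into an
  almost sure equality of measures. Finite intersections of traces of balls with centres
  \<open>s i\<close> and radii 1/(k+1) serve.\<close>

lemma countable_generator_restrict_borel:
  fixes S :: "'a::metric_space set"
  assumes s: "range s \<subseteq> S" "\<And>w e. w \<in> S \<Longrightarrow> e > 0 \<Longrightarrow> \<exists>i::nat. dist w (s i) < e"
  obtains E where "countable E" "Int_stable E" "E \<subseteq> Pow S" "S \<in> E" "sets (restrict_space borel S) = sigma_sets S E"
proof -
  define B where "B = range (\<lambda>(i, k). S \<inter> ball (s i) (inverse (real (Suc k))))"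
  define E where "E = insert S ((\<lambda>F. S \<inter> \<Inter>F) ` {F. finite F \<and> F \<subseteq> B})"
  have cB: "countable B" unfolding B_def by simp
  show thesis
  proof
    show "countable E" unfolding E_def
      by (intro countable_insert countable_image countable_Collect_finite_subset cB)
    have iE: "S \<inter> \<Inter>F \<in> E" if "finite F" "F \<subseteq> B" for F using that unfolding E_def by blast
    have eE: "\<exists>F. finite F \<and> F \<subseteq> B \<and> A = S \<inter> \<Inter>F" if "A \<in> E" for A using that unfolding E_def
      by (auto intro: exI[of _ "{}"])
    show "Int_stable E"
    proof (rule Int_stableI)
      fix A A' assume "A \<in> E" "A' \<in> E"
      then obtain F F' where "finite F" "F \<subseteq> B" "A = S \<inter> \<Inter>F" "finite F'" "F' \<subseteq> B" "A' = S \<inter> \<Inter>F'"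
        using eE by metis
      then show "A \<inter> A' \<in> E" using iE[of "F \<union> F'"] by (simp add: Inter_Un_distrib Int_ac)
    qed
    show EP: "E \<subseteq> Pow S" "S \<in> E" unfolding E_def by auto
    have BE: "B \<subseteq> E"
    proof
      fix b assume "b \<in> B" then have "S \<inter> \<Inter>{b} \<in> E" "b \<subseteq> S" using iE[of "{b}"] by (auto simp: B_def)
      then show "b \<in> E" by (simp add: Int_absorb1)
    qed
    show "sets (restrict_space borel S) = sigma_sets S E"
    proof (rule subset_antisym)
      have "B \<subseteq> sets (restrict_space borel S)" unfolding B_def sets_restrict_space
        by (intro image_subsetI) (auto intro!: imageI)
      moreover have "S \<in> sets (restrict_space borel S)" using sets.top[of "restrict_space borel S"] by (simp add: space_restrict_space)
      ultimately have "E \<subseteq> sets (restrict_space borel S)"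
      proof (intro subsetI)
        fix A assume BS: "B \<subseteq> sets (restrict_space borel S)" and S: "S \<in> sets (restrict_space borel S)" and "A \<in> E"
        then obtain F where F: "finite F" "F \<subseteq> B" "A = S \<inter> \<Inter>F" using eE by blast
        from F(1,2) have "S \<inter> \<Inter>F \<in> sets (restrict_space borel S)"
        proof induction
          case (insert b F)
          then have "b \<in> sets (restrict_space borel S)" "S \<inter> \<Inter>F \<in> sets (restrict_space borel S)"
            using BS by auto
          then have "b \<inter> (S \<inter> \<Inter>F) \<in> sets (restrict_space borel S)" by (rule sets.Int)
          moreover have "b \<inter> (S \<inter> \<Inter>F) = S \<inter> \<Inter>(insert b F)" by auto
          ultimately show ?case by (simp only:)
        qed (use S in simp)
        then show "A \<in> sets (restrict_space borel S)" using F by simp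
      qed
      then show "sigma_sets S E \<subseteq> sets (restrict_space borel S)"
        using sets.sigma_sets_subset[of E "restrict_space borel S"] by (simp add: space_restrict_space)
      have op: "S \<inter> W \<in> sigma_sets S E" if W: "open W" for W
      proof -
        \<comment> \<open>The generating traces inside \<open>W\<close> already cover
          \<open>S \<inter> W\<close>: a ball of radius below e/2 that contains w lies in the ball
          of radius e around w.\<close>
        define I where "I = {b \<in> B. b \<subseteq> W}"
        have "S \<inter> W = \<Union>I"
        proof (intro subset_antisym subsetI)
          fix w assume w: "w \<in> S \<inter> W"
          then obtain e where e: "e > 0" "ball w e \<subseteq> W" using W by (meson IntD2 open_contains_ball)
          obtain k where k: "inverse (real (Suc k)) < e/2" using reals_Archimedean[of "e/2"] e by auto
          obtain i where i: "dist w (s i) < inverse (real (Suc k))" using s(2)[of w "inverse (real (Suc k))"] w by auto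
          have "ball (s i) (inverse (real (Suc k))) \<subseteq> ball w e"
          proof
            fix y assume "y \<in> ball (s i) (inverse (real (Suc k)))"
            then have "dist w y < e" using i k dist_triangle[of w y "s i"] by simp
            then show "y \<in> ball w e" by simp
          qed
          then have "S \<inter> ball (s i) (inverse (real (Suc k))) \<in> I" using e unfolding I_def B_def by auto
          moreover have "w \<in> S \<inter> ball (s i) (inverse (real (Suc k)))" using w i by (simp add: dist_commute)
          ultimately show "w \<in> \<Union>I" by blast
        qed (auto simp: I_def B_def)
        moreover have "\<Union>I \<in> sigma_sets S E"
        proof (rule sigma_sets_UNION)
          show "countable I" unfolding I_def using cB by (rule countable_subset[rotated]) auto
          show "\<And>b. b \<in> I \<Longrightarrow> b \<in> sigma_sets S E" using BE by (auto simp: I_def)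
        qed
        ultimately show ?thesis by simp
      qed
      have "(\<lambda>x. x) \<in> sigma S E \<rightarrow>\<^sub>M borel"
      proof (rule borel_measurableI)
        fix W :: "'a set" assume "open W"
        then show "(\<lambda>x. x) -` W \<inter> space (sigma S E) \<in> sets (sigma S E)"
          using op[of W] EP(1) by (simp add: Int_commute)
      qed
      from measurable_sets[OF this] show "sets (restrict_space borel S) \<subseteq> sigma_sets S E"
        using EP(1) by (auto simp: sets_restrict_space Int_commute)
    qed
  qed
qed

section \<open>Kernel products and adjoints\<close>

lemma kernel_prod_kernel_measurable:
  fixes k :: "'a::{real_normed_vector,second_countable_topology} \<Rightarrow> 'b::real_normed_vector measure"
  assumes "f \<in> N \<rightarrow>\<^sub>M borel" "K \<in> N \<rightarrow>\<^sub>M prob_algebra (restrict_space borel U)"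
  shows "(\<lambda>\<omega>. distr (K \<omega>) (restrict_space borel (UNIV \<times> U)) (\<lambda>u. (f \<omega> :: 'a, u :: 'b))) \<in>
    N \<rightarrow>\<^sub>M prob_algebra (restrict_space borel (UNIV \<times> U))"
proof (rule measurable_distr_prob_space2[OF assms(2)])
  have "(\<lambda>p. (f (fst p), snd p)) \<in> N \<Otimes>\<^sub>M restrict_space borel U \<rightarrow>\<^sub>M borel \<Otimes>\<^sub>M restrict_space borel U"
    using assms(1) by measurable
  then show "(\<lambda>(x, y). (f x, y)) \<in> N \<Otimes>\<^sub>M restrict_space borel U \<rightarrow>\<^sub>M restrict_space borel (UNIV \<times> U)"
    by (simp add: case_prod_beta' measurable_cong_sets[OF refl sets_restrict_borel_UNIV_Times])
qed

lemma kernel_prod_measurable: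
  fixes \<mu> :: "'w \<Rightarrow> 'a::{real_normed_vector,second_countable_topology} measure"
    and a :: "'w \<Rightarrow> 'a \<Rightarrow> 'b::real_normed_vector measure"
  assumes "\<mu> \<in> G \<rightarrow>\<^sub>M prob_algebra borel"
    and "(\<lambda>(\<omega>, x). a \<omega> x) \<in> G \<Otimes>\<^sub>M borel \<rightarrow>\<^sub>M prob_algebra (restrict_space borel U)"
  shows "(\<lambda>\<omega>. kernel_prod U (\<mu> \<omega>) (a \<omega>)) \<in> G \<rightarrow>\<^sub>M prob_algebra (restrict_space borel (UNIV \<times> U))"
  unfolding kernel_prod_def
proof (rule measurable_bind_prob_space2[OF assms(1)])
  show "(\<lambda>(\<omega>, x). distr (a \<omega> x) (restrict_space borel (UNIV \<times> U)) (Pair x)) \<in>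
    G \<Otimes>\<^sub>M borel \<rightarrow>\<^sub>M prob_algebra (restrict_space borel (UNIV \<times> U))"
    using kernel_prod_kernel_measurable[of snd "G \<Otimes>\<^sub>M borel" "\<lambda>(\<omega>, x). a \<omega> x" U] assms(2)
    by (simp add: case_prod_beta')
qed

text \<open>The fibre of the mixture over \<open>x\<close> is the image of \<open>k x\<close> under
  \<open>Pair x\<close>, so integrals become iterated ones. The nonnegative form presupposes no
  integrability and can therefore be used to prove that second moments are finite.\<close>

lemma nn_integral_kernel_prod:
  fixes \<nu> :: "'a::{real_normed_vector,second_countable_topology} measure"
    and k :: "'a \<Rightarrow> 'b::real_normed_vector measure"
  assumes \<nu>: "sets \<nu> = sets borel" and k: "k \<in> kernels U"
    and f: "f \<in> borel_measurable (restrict_space borel (UNIV \<times> U))"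
  shows "(\<integral>\<^sup>+p. f p \<partial>kernel_prod U \<nu> k) = (\<integral>\<^sup>+x. \<integral>\<^sup>+u. f (x, u) \<partial>k x \<partial>\<nu>)"
proof -
  have k': "k \<in> borel \<rightarrow>\<^sub>M prob_algebra (restrict_space borel U)" using k by (simp add: kernels_def)
  have "(\<lambda>x. distr (k x) (restrict_space borel (UNIV \<times> U)) (Pair x)) \<in>
    borel \<rightarrow>\<^sub>M prob_algebra (restrict_space borel (UNIV \<times> U))"
    using kernel_prod_kernel_measurable[of "\<lambda>x. x" borel k U] k' by simp
  then have m: "(\<lambda>x. distr (k x) (restrict_space borel (UNIV \<times> U)) (Pair x)) \<in>
    \<nu> \<rightarrow>\<^sub>M subprob_algebra (restrict_space borel (UNIV \<times> U))"
    using measurable_prob_algebraD by (simp add: measurable_cong_sets[OF \<nu> refl])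
  show ?thesis
    unfolding kernel_prod_def nn_integral_bind[OF f m]
  proof (intro nn_integral_cong nn_integral_distr f)
    fix x
    have "sets (k x) = sets (restrict_space borel U)"
      using measurable_space[OF k', of x] by (simp add: space_prob_algebra)
    then show "Pair x \<in> k x \<rightarrow>\<^sub>M restrict_space borel (UNIV \<times> U)"
      by (simp add: measurable_cong_sets[OF _ sets_restrict_borel_UNIV_Times])
  qed (use f in simp)
qed

lemma integral_kernel_prod:
  fixes \<nu> :: "'a::{real_normed_vector,second_countable_topology} measure"
    and k :: "'a \<Rightarrow> 'b::real_normed_vector measure" and f :: "_ \<Rightarrow> real"
  assumes \<nu>: "\<nu> \<in> space (prob_algebra borel)" and k: "k \<in> kernels U"
    and f: "f \<in> borel_measurable (restrict_space borel (UNIV \<times> U))" "\<And>p. \<bar>f p\<bar> \<le> C"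
  shows "(\<integral>p. f p \<partial>kernel_prod U \<nu> k) = (\<integral>x. \<integral>u. f (x, u) \<partial>k x \<partial>\<nu>)"
proof -
  have k': "k \<in> borel \<rightarrow>\<^sub>M prob_algebra (restrict_space borel U)" using k by (simp add: kernels_def)
  have \<nu>': "sets \<nu> = sets borel" "prob_space \<nu>" using \<nu> by (auto simp: space_prob_algebra)
  have "(\<lambda>x. distr (k x) (restrict_space borel (UNIV \<times> U)) (Pair x)) \<in>
    borel \<rightarrow>\<^sub>M prob_algebra (restrict_space borel (UNIV \<times> U))"
    using kernel_prod_kernel_measurable[of "\<lambda>x. x" borel k U] k' by simp
  then have m': "(\<lambda>x. distr (k x) (restrict_space borel (UNIV \<times> U)) (Pair x)) \<in>
    \<nu> \<rightarrow>\<^sub>M prob_algebra (restrict_space borel (UNIV \<times> U))"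
    by (simp add: measurable_cong_sets[OF \<nu>'(1) refl])
  have "(\<integral>p. f p \<partial>kernel_prod U \<nu> k) =
      (\<integral>x. \<integral>p. f p \<partial>distr (k x) (restrict_space borel (UNIV \<times> U)) (Pair x) \<partial>\<nu>)"
    unfolding kernel_prod_def
  \<comment> \<open>\<open>C\<close> bounds the integrand, and 1 bounds the mass of each fibre, a
    probability measure.\<close>
  proof (rule integral_bind[where B=C and B'=1, OF f(1) f(2) measurable_prob_algebraD[OF m']])
    show "finite_measure \<nu>" using \<nu>'(2) by (rule prob_space.finite_measure)
    have "prob_space (distr (k x) (restrict_space borel (UNIV \<times> U)) (Pair x))" if "x \<in> space \<nu>" for x
      using measurable_space[OF m' that] by (simp add: space_prob_algebra)
    then show "AE x in \<nu>. emeasure (distr (k x) (restrict_space borel (UNIV \<times> U)) (Pair x))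
        (space (distr (k x) (restrict_space borel (UNIV \<times> U)) (Pair x))) \<le> ennreal 1"
      by (intro AE_I2) (metis prob_space.emeasure_space_1 ennreal_1 order_refl)
  qed
  also have "\<dots> = (\<integral>x. \<integral>u. f (x, u) \<partial>k x \<partial>\<nu>)"
  proof (intro Bochner_Integration.integral_cong refl integral_distr f)
    fix x
    have "sets (k x) = sets (restrict_space borel U)"
      using measurable_space[OF k', of x] by (simp add: space_prob_algebra)
    then show "Pair x \<in> k x \<rightarrow>\<^sub>M restrict_space borel (UNIV \<times> U)"
      by (simp add: measurable_cong_sets[OF _ sets_restrict_borel_UNIV_Times])
  qed
  finally show ?thesis .
qed

lemma kernel_prod_prob:
  fixes \<nu> :: "'a::{real_normed_vector,second_countable_topology} measure"
    and k :: "'a \<Rightarrow> 'b::real_normed_vector measure"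
  assumes \<nu>: "\<nu> \<in> space (prob_algebra borel)" and k: "k \<in> kernels U"
  shows "kernel_prod U \<nu> k \<in> space (prob_algebra (restrict_space borel (UNIV \<times> U)))"
proof -
  \<comment> \<open>A one-point parameter space turns the single kernel into a measurable
    family.\<close>
  have "(\<lambda>(\<omega>::unit, x). k x) \<in> count_space UNIV \<Otimes>\<^sub>M borel \<rightarrow>\<^sub>M prob_algebra (restrict_space borel U)"
    using k unfolding kernels_def case_prod_beta' by (rule measurable_compose[OF measurable_snd])
  then show ?thesis
    using measurable_space[OF kernel_prod_measurable[of "\<lambda>_. \<nu>" "count_space UNIV" "\<lambda>_. k" U]] \<nu>
    by auto
qed

text \<open>If \<open>C\<close> bounds the norm on \<open>U\<close>, the second moment exceeds that
  of \<open>\<nu>\<close> by at most the square of \<open>C\<close>.\<close>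

lemma kernel_prod_P2:
  fixes \<nu> :: "'a::{real_normed_vector,second_countable_topology} measure"
    and k :: "'a \<Rightarrow> 'b::real_normed_vector measure"
  assumes \<nu>: "\<nu> \<in> P2 UNIV" and k: "k \<in> kernels U" and U: "bounded U"
  shows "kernel_prod U \<nu> k \<in> P2 (UNIV \<times> U)"
proof -
  let ?W = "restrict_space borel ((UNIV :: 'a set) \<times> U)"
  have sn: "sets \<nu> = sets borel" and pn: "prob_space \<nu>" and i: "integrable \<nu> (\<lambda>p. (norm p)\<^sup>2)"
    using \<nu> by (auto simp: P2_def)
  have k': "k \<in> borel \<rightarrow>\<^sub>M prob_algebra (restrict_space borel U)" using k by (simp add: kernels_def)
  have kp: "kernel_prod U \<nu> k \<in> space (prob_algebra ?W)"
    by (rule kernel_prod_prob) (use sn pn k in \<open>auto simp: space_prob_algebra\<close>)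
  then have s: "sets (kernel_prod U \<nu> k) = sets ?W" and p: "prob_space (kernel_prod U \<nu> k)"
    by (auto simp: space_prob_algebra)
  obtain C where C: "\<And>u. u \<in> U \<Longrightarrow> norm u \<le> C" using U by (auto simp: bounded_iff)
  have nm: "(\<lambda>p. (norm p)\<^sup>2) \<in> borel_measurable ?W"
    by (intro measurable_restrict_space1 borel_measurable_continuous_onI continuous_intros)
  have "(\<integral>\<^sup>+p. ennreal ((norm p)\<^sup>2) \<partial>kernel_prod U \<nu> k) = (\<integral>\<^sup>+x. \<integral>\<^sup>+u. ennreal ((norm (x, u))\<^sup>2) \<partial>k x \<partial>\<nu>)"
    by (rule nn_integral_kernel_prod[OF sn k]) (use nm in measurable)
  also have "\<dots> \<le> (\<integral>\<^sup>+x. ennreal ((norm x)\<^sup>2 + C\<^sup>2) \<partial>\<nu>)"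
  proof (intro nn_integral_mono)
    fix x
    have kx: "prob_space (k x)" "sets (k x) = sets (restrict_space borel U)"
      using measurable_space[OF k', of x] by (auto simp: space_prob_algebra)
    have "(\<integral>\<^sup>+u. ennreal ((norm (x, u))\<^sup>2) \<partial>k x) \<le> (\<integral>\<^sup>+u. ennreal ((norm x)\<^sup>2 + C\<^sup>2) \<partial>k x)"
    proof (intro nn_integral_mono ennreal_leI)
      fix u assume "u \<in> space (k x)"
      then have "u \<in> U" using sets_eq_imp_space_eq[OF kx(2)] by (simp add: space_restrict_space)
      then have "(norm u)\<^sup>2 \<le> C\<^sup>2" using C by (intro power_mono) auto
      then show "(norm (x, u))\<^sup>2 \<le> (norm x)\<^sup>2 + C\<^sup>2" by (simp add: norm_Pair)
    qed
    also have "\<dots> = ennreal ((norm x)\<^sup>2 + C\<^sup>2)" using prob_space.emeasure_space_1[OF kx(1)] by simp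
    finally show "(\<integral>\<^sup>+u. ennreal ((norm (x, u))\<^sup>2) \<partial>k x) \<le> ennreal ((norm x)\<^sup>2 + C\<^sup>2)" .
  qed
  also have "\<dots> < \<infinity>"
  proof -
    interpret prob_space \<nu> by (rule pn)
    have "integrable \<nu> (\<lambda>x. (norm x)\<^sup>2 + C\<^sup>2)" using i by simp
    from integrableD(2)[OF this] show ?thesis by (simp add: top.not_eq_extremum less_top)
  qed
  finally have "integrable (kernel_prod U \<nu> k) (\<lambda>p. (norm p)\<^sup>2)"
    using nm by (intro integrableI_nonneg) (auto simp: measurable_cong_sets[OF s refl])
  then show ?thesis using s p by (simp add: P2_def)
qed

text \<open>Supplies the uniqueness behind the definite description in \<open>adjoint_meas\<close>.
  Indicators of closed sets are decreasing limits of continuous cut-offs with slope n, and the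
  closed sets form a pi-system generating the Borel sets.\<close>

lemma borel_prob_measure_eqI:
  fixes \<nu> \<nu>' :: "'a::metric_space measure"
  assumes \<nu>: "prob_space \<nu>" "sets \<nu> = sets borel" and \<nu>': "prob_space \<nu>'" "sets \<nu>' = sets borel"
    and eq: "\<And>\<phi> :: 'a \<Rightarrow> real. \<phi> \<in> bcontfun \<Longrightarrow> (\<integral>x. \<phi> x \<partial>\<nu>) = (\<integral>x. \<phi> x \<partial>\<nu>')"
  shows "\<nu> = \<nu>'"
proof -
  interpret p1: prob_space \<nu> by fact
  interpret p2: prob_space \<nu>' by fact
  \<comment> \<open>By convention \<open>infdist x {}\<close> is 0, so the cut-offs of the empty set
    would be constantly 1; that set is treated separately at the end.\<close>
  have closed_eq: "measure \<nu> C = measure \<nu>' C" if C: "closed C" "C \<noteq> {}" for C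
  proof -
    define g where "g n x = max 0 (1 - real n * infdist x C)" for n x
    have g: "g n \<in> bcontfun" for n
    proof -
      have "continuous_on UNIV (g n)" unfolding g_def by (intro continuous_intros)
      moreover have "range (g n) \<subseteq> {0..1}" by (auto simp: g_def infdist_nonneg)
      ultimately show ?thesis
        unfolding bcontfun_def using bounded_subset[OF bounded_closed_interval] by blast
    qed
    have lim: "(\<lambda>n. g n x) \<longlonglongrightarrow> indicator C x" for x
    proof (cases "x \<in> C")
      case True then show ?thesis by (simp add: g_def)
    next
      case False
      then have pos: "infdist x C > 0"
        using C by (metis in_closed_iff_infdist_zero infdist_nonneg less_eq_real_def)
      have "eventually (\<lambda>n. g n x = 0) sequentially"
        using eventually_ge_at_top[of "nat \<lceil>1 / infdist x C\<rceil>"]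
      proof eventually_elim
        case (elim n)
        then have "1 / infdist x C \<le> real n" by linarith
        then have "1 \<le> real n * infdist x C" using pos by (simp add: field_simps)
        then show "g n x = 0" by (simp add: g_def)
      qed
      then show ?thesis using False by (simp add: tendsto_eventually)
    qed
    have L: "(\<lambda>n. \<integral>x. g n x \<partial>q) \<longlonglongrightarrow> measure q C" if q: "prob_space q" "sets q = sets borel" for q
    proof -
      interpret prob_space q by fact
      have "(\<lambda>n. \<integral>x. g n x \<partial>q) \<longlonglongrightarrow> (\<integral>x. indicator C x \<partial>q)"
      proof (rule integral_dominated_convergence[where w="\<lambda>_. 1"])
        show "indicator C \<in> borel_measurable q" using C q(2) by (intro borel_measurable_indicator) auto
        show "AE x in q. (\<lambda>n. g n x) \<longlonglongrightarrow> indicator C x" by (simp add: lim)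
        show "g n \<in> borel_measurable q" for n
          using g[of n] borel_measurable_continuous_onI[of "g n"]
          by (simp add: bcontfun_def measurable_cong_sets[OF q(2) refl])
      qed (auto simp: g_def infdist_nonneg)
      then show ?thesis using C q sets_eq_imp_space_eq[OF q(2)] by simp
    qed
    show ?thesis using LIMSEQ_unique[OF L[OF \<nu>]] L[OF \<nu>'] eq[OF g] by simp
  qed
  show ?thesis
  proof (rule measure_eqI_generator_eq[of "Collect closed" UNIV _ _ "\<lambda>_. UNIV"])
    show "Int_stable (Collect closed :: 'a set set)" by (auto simp: Int_stable_def)
    show "emeasure \<nu> X = emeasure \<nu>' X" if "X \<in> Collect closed" for X
      using closed_eq[of X] that
      by (cases "X = {}") (auto simp: p1.emeasure_eq_measure p2.emeasure_eq_measure)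
    show "sets \<nu> = sigma_sets UNIV (Collect closed)" "sets \<nu>' = sigma_sets UNIV (Collect closed)"
      using \<nu> \<nu>' by (simp_all add: borel_eq_closed)
  qed auto
qed

text \<open>Iterated integration turns the pairing of the operator with \<open>\<nu>\<close> into an
  integral of \<open>\<phi> \<circ> g\<close> against the product of \<open>\<nu>\<close> and
  \<open>k\<close>, that is, of \<open>\<phi>\<close> against the image law. The law inside
  \<open>\<gamma>\<close> is absorbed into \<open>g\<close>, so it may differ from the law
  \<open>\<nu>\<close> acted upon.\<close>

lemma adjoint_meas_kernel:
  fixes \<nu> :: "'a::{real_normed_vector,second_countable_topology} measure"
    and k :: "'a \<Rightarrow> 'b::real_normed_vector measure" and g :: "'a \<times> 'b \<Rightarrow> 'a"
  assumes \<nu>: "\<nu> \<in> space (prob_algebra borel)" and k: "k \<in> kernels U"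
    and g: "g \<in> restrict_space borel (UNIV \<times> U) \<rightarrow>\<^sub>M borel"
  shows "adjoint_meas (\<lambda>\<phi> x. \<integral>u. \<phi> (g (x, u)) \<partial>k x) \<nu> = distr (kernel_prod U \<nu> k) borel g"
proof -
  have kp: "prob_space (kernel_prod U \<nu> k)"
    "sets (kernel_prod U \<nu> k) = sets (restrict_space borel (UNIV \<times> U))"
    using kernel_prod_prob[OF \<nu> k] by (auto simp: space_prob_algebra)
  have g': "g \<in> kernel_prod U \<nu> k \<rightarrow>\<^sub>M borel" using g by (simp add: measurable_cong_sets[OF kp(2) refl])
  let ?\<nu> = "distr (kernel_prod U \<nu> k) borel g"
  have int: "(\<integral>x. \<phi> x \<partial>?\<nu>) = (\<integral>x. \<integral>u. \<phi> (g (x, u)) \<partial>k x \<partial>\<nu>)" if \<phi>: "\<phi> \<in> bcontfun" for \<phi> :: "'a \<Rightarrow> real"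
  proof -
    have m: "\<phi> \<in> borel_measurable borel"
      using \<phi> by (intro borel_measurable_continuous_onI) (simp add: bcontfun_def)
    obtain C where C: "\<And>x. \<bar>\<phi> x\<bar> \<le> C" using \<phi> by (auto simp: bcontfun_def bounded_iff)
    have "(\<integral>x. \<phi> x \<partial>?\<nu>) = (\<integral>p. \<phi> (g p) \<partial>kernel_prod U \<nu> k)"
      by (rule integral_distr[OF g' m])
    also have "\<dots> = (\<integral>x. \<integral>u. \<phi> (g (x, u)) \<partial>k x \<partial>\<nu>)"
      by (rule integral_kernel_prod[OF \<nu> k measurable_compose[OF g m]]) (rule C)
    finally show ?thesis .
  qed
  have p: "prob_space ?\<nu>" "sets ?\<nu> = sets borel"
    using prob_space.prob_space_distr[OF kp(1) g'] by auto
  show ?thesis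
    unfolding adjoint_meas_def
  proof (rule the_equality)
    show "prob_space ?\<nu> \<and> sets ?\<nu> = sets borel \<and>
      (\<forall>\<phi>\<in>bcontfun. (\<integral>x. (\<phi> x :: real) \<partial>?\<nu>) = (\<integral>x. \<integral>u. \<phi> (g (x, u)) \<partial>k x \<partial>\<nu>))"
      using p int by blast
    show "\<nu>' = ?\<nu>" if "prob_space \<nu>' \<and> sets \<nu>' = sets borel \<and>
      (\<forall>\<phi>\<in>bcontfun. (\<integral>x. (\<phi> x :: real) \<partial>\<nu>') = (\<integral>x. \<integral>u. \<phi> (g (x, u)) \<partial>k x \<partial>\<nu>))" for \<nu>'
      by (rule borel_prob_measure_eqI) (use that p int in auto)
  qed
qed

section \<open>Regular conditional laws\<close>

lemma sigma_finite_subalgebraI: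
  assumes "prob_space M" "subalgebra M G"
  shows "sigma_finite_subalgebra M G"
  using assms by (intro finite_measure_subalgebra_is_sigma_finite
    finite_measure_subalgebra.intro finite_measure_subalgebra_axioms.intro prob_space.finite_measure)

text \<open>Trades a conditional expectation, known only almost everywhere and for each set
  separately, for an exact identity on rectangles \<open>A \<times> B\<close>.\<close>

lemma reg_cond_law_emeasure:
  assumes M: "prob_space M" and G: "subalgebra M G" and r: "reg_cond_law M G N Y \<kappa>"
    and A: "A \<in> sets G" and B: "B \<in> sets N"
  shows "emeasure M {\<omega> \<in> space M. \<omega> \<in> A \<and> Y \<omega> \<in> B} = (\<integral>\<^sup>+\<omega>. indicator A \<omega> * emeasure (\<kappa> \<omega>) B \<partial>M)"
proof -
  interpret prob_space M by fact
  interpret sigma_finite_subalgebra M G by (rule sigma_finite_subalgebraI[OF M G])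
  have Y: "Y \<in> M \<rightarrow>\<^sub>M N" and \<kappa>: "\<kappa> \<in> G \<rightarrow>\<^sub>M prob_algebra N"
    and ae: "AE \<omega> in M. measure (\<kappa> \<omega>) B = real_cond_exp M G (\<lambda>\<omega>'. indicator B (Y \<omega>')) \<omega>"
    using r B by (auto simp: reg_cond_law_def)
  have AM: "A \<in> sets M" using A G by (auto simp: subalgebra_def)
  have \<kappa>M: "\<kappa> \<in> M \<rightarrow>\<^sub>M prob_algebra N" by (rule measurable_from_subalg[OF G \<kappa>])
  have \<kappa>p: "prob_space (\<kappa> \<omega>)" if "\<omega> \<in> space M" for \<omega>
    using measurable_space[OF \<kappa>M that] by (simp add: space_prob_algebra)
  have mB: "(\<lambda>\<omega>. measure (\<kappa> \<omega>) B) \<in> borel_measurable M"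
    using measurable_prob_algebraD[OF \<kappa>M] B by measurable
  have i1: "integrable M (\<lambda>\<omega>. indicator B (Y \<omega>) :: real)"
    by (rule integrable_const_bound[of _ 1]) (use Y B in \<open>auto simp: indicator_def\<close>)
  have i2: "integrable M (\<lambda>\<omega>. indicator A \<omega> * measure (\<kappa> \<omega>) B)"
    by (rule integrable_const_bound[of _ 1])
      (use AM mB \<kappa>p in \<open>auto simp: indicator_def intro!: AE_I2 prob_space.prob_le_1\<close>)
  have "measure M {\<omega> \<in> space M. \<omega> \<in> A \<and> Y \<omega> \<in> B} = (\<integral>\<omega>. indicator {\<omega> \<in> space M. \<omega> \<in> A \<and> Y \<omega> \<in> B} \<omega> \<partial>M)"
    by (simp add: Int_absorb2 subset_eq)
  also have "\<dots> = set_lebesgue_integral M A (\<lambda>\<omega>. indicator B (Y \<omega>))"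
    unfolding set_lebesgue_integral_def
    by (intro Bochner_Integration.integral_cong) (auto simp: indicator_def)
  also have "\<dots> = set_lebesgue_integral M A (real_cond_exp M G (\<lambda>\<omega>. indicator B (Y \<omega>)))"
    by (rule real_cond_exp_intA[OF i1 A])
  also have "\<dots> = (\<integral>\<omega>. indicator A \<omega> * measure (\<kappa> \<omega>) B \<partial>M)"
    unfolding set_lebesgue_integral_def
  proof (rule integral_cong_AE)
    show "AE \<omega> in M. indicator A \<omega> *\<^sub>R real_cond_exp M G (\<lambda>\<omega>. indicator B (Y \<omega>)) \<omega> =
      indicator A \<omega> * measure (\<kappa> \<omega>) B" using ae by eventually_elim simp
  qed (use AM mB in measurable)
  finally have "emeasure M {\<omega> \<in> space M. \<omega> \<in> A \<and> Y \<omega> \<in> B} = ennreal (\<integral>\<omega>. indicator A \<omega> * measure (\<kappa> \<omega>) B \<partial>M)"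
    by (simp add: emeasure_eq_measure)
  also have "\<dots> = (\<integral>\<^sup>+\<omega>. ennreal (indicator A \<omega> * measure (\<kappa> \<omega>) B) \<partial>M)"
    by (rule nn_integral_eq_integral[symmetric, OF i2]) auto
  also have "\<dots> = (\<integral>\<^sup>+\<omega>. indicator A \<omega> * emeasure (\<kappa> \<omega>) B \<partial>M)"
  proof (rule nn_integral_cong)
    fix \<omega> assume "\<omega> \<in> space M"
    then interpret k: prob_space "\<kappa> \<omega>" by (rule \<kappa>p)
    show "ennreal (indicator A \<omega> * measure (\<kappa> \<omega>) B) = indicator A \<omega> * emeasure (\<kappa> \<omega>) B"
      by (simp add: k.emeasure_eq_measure indicator_def)
  qed
  finally show ?thesis .
qed

text \<open>The converse passage: a candidate kernel is verified by identities between nonnegative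
  integrals, because integrals over the sets of \<open>G\<close> determine a conditional
  expectation.\<close>

lemma reg_cond_lawI:
  assumes M: "prob_space M" and G: "subalgebra M G" and Y: "Y \<in> M \<rightarrow>\<^sub>M N"
    and \<kappa>: "\<kappa> \<in> G \<rightarrow>\<^sub>M prob_algebra N"
    and eq: "\<And>A B. A \<in> sets G \<Longrightarrow> B \<in> sets N \<Longrightarrow>
      emeasure M {\<omega> \<in> space M. \<omega> \<in> A \<and> Y \<omega> \<in> B} = (\<integral>\<^sup>+\<omega>. indicator A \<omega> * emeasure (\<kappa> \<omega>) B \<partial>M)"
  shows "reg_cond_law M G N Y \<kappa>"
  unfolding reg_cond_law_def
proof (intro conjI Y \<kappa> ballI)
  fix B assume B: "B \<in> sets N"
  interpret prob_space M by fact
  interpret sigma_finite_subalgebra M G by (rule sigma_finite_subalgebraI[OF M G])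
  have \<kappa>M: "\<kappa> \<in> M \<rightarrow>\<^sub>M prob_algebra N" by (rule measurable_from_subalg[OF G \<kappa>])
  have \<kappa>p: "prob_space (\<kappa> \<omega>)" if "\<omega> \<in> space M" for \<omega>
    using measurable_space[OF \<kappa>M that] by (simp add: space_prob_algebra)
  have mG: "(\<lambda>\<omega>. measure (\<kappa> \<omega>) B) \<in> borel_measurable G"
    using measurable_prob_algebraD[OF \<kappa>] B by measurable
  have mB: "(\<lambda>\<omega>. measure (\<kappa> \<omega>) B) \<in> borel_measurable M"
    by (rule measurable_from_subalg[OF G mG])
  have i1: "integrable M (\<lambda>\<omega>. indicator B (Y \<omega>) :: real)"
    by (rule integrable_const_bound[of _ 1]) (use Y B in \<open>auto simp: indicator_def\<close>)
  have i2: "integrable M (\<lambda>\<omega>. measure (\<kappa> \<omega>) B)"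
    by (rule integrable_const_bound[of _ 1])
      (use mB \<kappa>p in \<open>auto intro!: AE_I2 prob_space.prob_le_1\<close>)
  have "AE \<omega> in M. real_cond_exp M G (\<lambda>\<omega>'. indicator B (Y \<omega>')) \<omega> = measure (\<kappa> \<omega>) B"
  proof (rule real_cond_exp_charact[OF _ i1 i2 mG])
    fix A assume A: "A \<in> sets G"
    then have AM: "A \<in> sets M" using G by (auto simp: subalgebra_def)
    have i2': "integrable M (\<lambda>\<omega>. indicator A \<omega> * measure (\<kappa> \<omega>) B)"
      by (rule integrable_const_bound[of _ 1])
        (use AM mB \<kappa>p in \<open>auto simp: indicator_def intro!: AE_I2 prob_space.prob_le_1\<close>)
    have "set_lebesgue_integral M A (\<lambda>\<omega>. indicator B (Y \<omega>)) =
       (\<integral>\<omega>. indicator {\<omega> \<in> space M. \<omega> \<in> A \<and> Y \<omega> \<in> B} \<omega> \<partial>M)"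
      unfolding set_lebesgue_integral_def
      by (intro Bochner_Integration.integral_cong) (auto simp: indicator_def)
    also have "\<dots> = measure M {\<omega> \<in> space M. \<omega> \<in> A \<and> Y \<omega> \<in> B}"
      by (simp add: Int_absorb2 subset_eq)
    finally have 1: "ennreal (set_lebesgue_integral M A (\<lambda>\<omega>. indicator B (Y \<omega>))) =
      (\<integral>\<^sup>+\<omega>. indicator A \<omega> * emeasure (\<kappa> \<omega>) B \<partial>M)"
      using eq[OF A B] by (simp add: emeasure_eq_measure)
    have "(\<integral>\<^sup>+\<omega>. indicator A \<omega> * emeasure (\<kappa> \<omega>) B \<partial>M) =
      (\<integral>\<^sup>+\<omega>. ennreal (indicator A \<omega> * measure (\<kappa> \<omega>) B) \<partial>M)"
    proof (rule nn_integral_cong)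
      fix \<omega> assume "\<omega> \<in> space M"
      then interpret k: prob_space "\<kappa> \<omega>" by (rule \<kappa>p)
      show "indicator A \<omega> * emeasure (\<kappa> \<omega>) B = ennreal (indicator A \<omega> * measure (\<kappa> \<omega>) B)"
        by (simp add: k.emeasure_eq_measure indicator_def)
    qed
    also have "\<dots> = ennreal (\<integral>\<omega>. indicator A \<omega> * measure (\<kappa> \<omega>) B \<partial>M)"
      by (rule nn_integral_eq_integral[OF i2']) auto
    also have "\<dots> = ennreal (set_lebesgue_integral M A (\<lambda>\<omega>. measure (\<kappa> \<omega>) B))"
      unfolding set_lebesgue_integral_def by simp
    finally show "set_lebesgue_integral M A (\<lambda>\<omega>. indicator B (Y \<omega>)) =
      set_lebesgue_integral M A (\<lambda>\<omega>. measure (\<kappa> \<omega>) B)"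
      using 1 by (simp add: ennreal_inj set_lebesgue_integral_def integral_nonneg_AE)
  qed
  then show "AE \<omega> in M. measure (\<kappa> \<omega>) B = real_cond_exp M G (\<lambda>\<omega>'. indicator B (Y \<omega>')) \<omega>"
    by eventually_elim simp
qed

text \<open>The freezing formula: given \<open>G\<close>, the first argument of \<open>f\<close> is
  constant and only \<open>Y\<close> is averaged. The law of \<open>(\<omega>, Y \<omega>)\<close>
  and the mixture of the \<open>\<kappa> \<omega>\<close> placed on the fibres over
  \<open>\<omega>\<close> agree on rectangles, a generating pi-system.\<close>

lemma nn_integral_reg_cond_law:
  assumes M: "prob_space M" and G: "subalgebra M G" and r: "reg_cond_law M G N Y \<kappa>"
    and f: "f \<in> borel_measurable (G \<Otimes>\<^sub>M N)"
  shows "(\<integral>\<^sup>+\<omega>. f (\<omega>, Y \<omega>) \<partial>M) = (\<integral>\<^sup>+\<omega>. \<integral>\<^sup>+y. f (\<omega>, y) \<partial>\<kappa> \<omega> \<partial>M)"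
proof -
  interpret prob_space M by fact
  have Y: "Y \<in> M \<rightarrow>\<^sub>M N" and \<kappa>: "\<kappa> \<in> G \<rightarrow>\<^sub>M prob_algebra N"
    using r by (auto simp: reg_cond_law_def)
  have sG: "space G = space M" using G by (simp add: subalgebra_def)
  have \<kappa>M: "\<kappa> \<in> M \<rightarrow>\<^sub>M prob_algebra N" by (rule measurable_from_subalg[OF G \<kappa>])
  have \<kappa>s: "sets (\<kappa> \<omega>) = sets N" "prob_space (\<kappa> \<omega>)" if "\<omega> \<in> space M" for \<omega>
    using measurable_space[OF \<kappa>M that] by (auto simp: space_prob_algebra)
  have idMG: "(\<lambda>\<omega>. \<omega>) \<in> M \<rightarrow>\<^sub>M G" by (rule measurable_from_subalg[OF G]) simp
  have YG: "(\<lambda>\<omega>. (\<omega>, Y \<omega>)) \<in> M \<rightarrow>\<^sub>M G \<Otimes>\<^sub>M N" using idMG Y by measurable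
  have K: "(\<lambda>\<omega>. distr (\<kappa> \<omega>) (G \<Otimes>\<^sub>M N) (Pair \<omega>)) \<in> M \<rightarrow>\<^sub>M subprob_algebra (G \<Otimes>\<^sub>M N)"
  proof -
    have "(\<lambda>p. (fst p, snd p)) \<in> M \<Otimes>\<^sub>M N \<rightarrow>\<^sub>M G \<Otimes>\<^sub>M N"
      using measurable_compose[OF measurable_fst idMG] by measurable
    then have "(\<lambda>(\<omega>, y). (\<omega>, y)) \<in> M \<Otimes>\<^sub>M N \<rightarrow>\<^sub>M G \<Otimes>\<^sub>M N" by (simp add: case_prod_beta')
    from measurable_distr2[OF this measurable_prob_algebraD[OF \<kappa>M]] show ?thesis .
  qed
  have PM: "Pair \<omega> \<in> \<kappa> \<omega> \<rightarrow>\<^sub>M G \<Otimes>\<^sub>M N" if "\<omega> \<in> space M" for \<omega>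
    using that sG by (simp add: measurable_cong_sets[OF \<kappa>s(1)[OF that] refl])
  let ?P = "distr M (G \<Otimes>\<^sub>M N) (\<lambda>\<omega>. (\<omega>, Y \<omega>))"
  let ?Q = "M \<bind> (\<lambda>\<omega>. distr (\<kappa> \<omega>) (G \<Otimes>\<^sub>M N) (Pair \<omega>))"
  have sQ: "sets ?Q = sets (G \<Otimes>\<^sub>M N)" by (rule sets_bind[OF _ not_empty]) simp
  have "?P = ?Q"
  proof (rule measure_eqI_generator_eq[of "{a \<times> b |a b. a \<in> sets G \<and> b \<in> sets N}" "space G \<times> space N" _ _ "\<lambda>_. space G \<times> space N"])
    show "Int_stable {a \<times> b |a b. a \<in> sets G \<and> b \<in> sets N}"
      by (rule Int_stable_pair_measure_generator)
    show "{a \<times> b |a b. a \<in> sets G \<and> b \<in> sets N} \<subseteq> Pow (space G \<times> space N)"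
      by (rule pair_measure_closed)
    show "sets ?P = sigma_sets (space G \<times> space N) {a \<times> b |a b. a \<in> sets G \<and> b \<in> sets N}"
      by (simp add: sets_pair_measure)
    show "sets ?Q = sigma_sets (space G \<times> space N) {a \<times> b |a b. a \<in> sets G \<and> b \<in> sets N}"
      unfolding sQ by (simp add: sets_pair_measure)
    have "prob_space ?P" using YG by (rule prob_space_distr)
    then show "emeasure ?P (space G \<times> space N) \<noteq> \<infinity>" for i :: nat
      using prob_space.emeasure_space_1[of ?P] by (simp add: space_pair_measure)
    show "emeasure ?P X = emeasure ?Q X" if X0: "X \<in> {a \<times> b |a b. a \<in> sets G \<and> b \<in> sets N}" for X
    proof -
      obtain A B where X: "X = A \<times> B" and A: "A \<in> sets G" and B: "B \<in> sets N" using X0 by blast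
      have XS: "X \<in> sets (G \<Otimes>\<^sub>M N)" unfolding X using A B by simp
      have "emeasure ?P X = emeasure M ((\<lambda>\<omega>. (\<omega>, Y \<omega>)) -` X \<inter> space M)"
        by (rule emeasure_distr[OF YG XS])
      also have "(\<lambda>\<omega>. (\<omega>, Y \<omega>)) -` X \<inter> space M = {\<omega> \<in> space M. \<omega> \<in> A \<and> Y \<omega> \<in> B}"
        unfolding X by auto
      also have "emeasure M \<dots> = (\<integral>\<^sup>+\<omega>. indicator A \<omega> * emeasure (\<kappa> \<omega>) B \<partial>M)"
        by (rule reg_cond_law_emeasure[OF M G r A B])
      also have "\<dots> = (\<integral>\<^sup>+\<omega>. emeasure (distr (\<kappa> \<omega>) (G \<Otimes>\<^sub>M N) (Pair \<omega>)) X \<partial>M)"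
      proof (rule nn_integral_cong)
        fix \<omega> assume \<omega>: "\<omega> \<in> space M"
        have "Pair \<omega> -` X \<inter> space (\<kappa> \<omega>) = (if \<omega> \<in> A then B else {})"
          using sets.sets_into_space[OF B] sets_eq_imp_space_eq[OF \<kappa>s(1)[OF \<omega>]] unfolding X by auto
        then show "indicator A \<omega> * emeasure (\<kappa> \<omega>) B = emeasure (distr (\<kappa> \<omega>) (G \<Otimes>\<^sub>M N) (Pair \<omega>)) X"
          by (simp add: emeasure_distr[OF PM[OF \<omega>] XS])
      qed
      also have "\<dots> = emeasure ?Q X"
        by (rule emeasure_bind[symmetric, OF not_empty K XS])
      finally show ?thesis .
    qed
  qed auto
  then have "(\<integral>\<^sup>+p. f p \<partial>?P) = (\<integral>\<^sup>+p. f p \<partial>?Q)" by simp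
  also have "\<dots> = (\<integral>\<^sup>+\<omega>. \<integral>\<^sup>+p. f p \<partial>distr (\<kappa> \<omega>) (G \<Otimes>\<^sub>M N) (Pair \<omega>) \<partial>M)"
    by (rule nn_integral_bind[OF f K])
  also have "\<dots> = (\<integral>\<^sup>+\<omega>. \<integral>\<^sup>+y. f (\<omega>, y) \<partial>\<kappa> \<omega> \<partial>M)"
    by (intro nn_integral_cong nn_integral_distr PM) (use f in simp_all)
  finally show ?thesis by (simp add: nn_integral_distr[OF YG] f)
qed

text \<open>Every test set has its own exceptional null set. Countability of \<open>E\<close> unites
  them, and off the union the two probability measures agree on a generating pi-system.\<close>

lemma reg_cond_law_unique:
  assumes M: "prob_space M" and G: "subalgebra M G"
    and r: "reg_cond_law M G N Y \<kappa>" "reg_cond_law M G N Y \<kappa>'"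
    and E: "countable E" "Int_stable E" "E \<subseteq> Pow \<Omega>" "\<Omega> \<in> E" "sets N = sigma_sets \<Omega> E"
  shows "AE \<omega> in M. \<kappa> \<omega> = \<kappa>' \<omega>"
proof -
  have EN: "E \<subseteq> sets N" unfolding E(5) by auto
  have k: "\<kappa> \<in> M \<rightarrow>\<^sub>M prob_algebra N" "\<kappa>' \<in> M \<rightarrow>\<^sub>M prob_algebra N"
    using r by (auto simp: reg_cond_law_def intro: measurable_from_subalg[OF G])
  have "AE \<omega> in M. \<forall>B\<in>E. measure (\<kappa> \<omega>) B = measure (\<kappa>' \<omega>) B"
  proof (subst AE_ball_countable[OF E(1)], rule ballI)
    fix B assume "B \<in> E"
    then have "AE \<omega> in M. measure (\<kappa> \<omega>) B = real_cond_exp M G (\<lambda>\<omega>'. indicator B (Y \<omega>')) \<omega>"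
      "AE \<omega> in M. measure (\<kappa>' \<omega>) B = real_cond_exp M G (\<lambda>\<omega>'. indicator B (Y \<omega>')) \<omega>"
      using r EN by (auto simp: reg_cond_law_def)
    then show "AE \<omega> in M. measure (\<kappa> \<omega>) B = measure (\<kappa>' \<omega>) B" by eventually_elim simp
  qed
  then show ?thesis
    using AE_space
  proof eventually_elim
    case (elim \<omega>)
    have s: "sets (\<kappa> \<omega>) = sets N" "prob_space (\<kappa> \<omega>)" "sets (\<kappa>' \<omega>) = sets N" "prob_space (\<kappa>' \<omega>)"
      using measurable_space[OF k(1) elim(2)] measurable_space[OF k(2) elim(2)]
      by (auto simp: space_prob_algebra)
    interpret p1: prob_space "\<kappa> \<omega>" by fact
    interpret p2: prob_space "\<kappa>' \<omega>" by fact
    show "\<kappa> \<omega> = \<kappa>' \<omega>"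
      by (rule measure_eqI_generator_eq[OF E(2,3), of _ _ "\<lambda>_. \<Omega>"])
        (use elim(1) s E(4,5) in \<open>auto simp: p1.emeasure_eq_measure p2.emeasure_eq_measure\<close>)
  qed
qed

section \<open>Conditioning on \<open>G\<close> and \<open>X\<close> jointly\<close>

lemma sets_sigma_join:
  "sets (sigma_join G X) =
    sigma_sets (space G) (sets G \<union> {X -` A \<inter> space G |A. A \<in> sets borel})"
  and space_sigma_join: "space (sigma_join G X) = space G"
proof -
  have "sets G \<union> {X -` A \<inter> space G |A. A \<in> sets borel} \<subseteq> Pow (space G)"
    using sets.space_closed[of G] by auto
  then show "sets (sigma_join G X) = sigma_sets (space G) (sets G \<union> {X -` A \<inter> space G |A. A \<in> sets borel})"
    and "space (sigma_join G X) = space G"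
    unfolding sigma_join_def by (simp_all add: sets_measure_of space_measure_of)
qed

lemma subalgebra_sigma_join:
  assumes "subalgebra M G" "X \<in> borel_measurable M"
  shows "subalgebra M (sigma_join G X)"
proof -
  have sp: "space G = space M" and st: "sets G \<subseteq> sets M" using assms(1) by (auto simp: subalgebra_def)
  have "sets G \<union> {X -` A \<inter> space G |A. A \<in> sets borel} \<subseteq> sets M"
    using st measurable_sets[OF assms(2)] unfolding sp by auto
  then show ?thesis
    unfolding subalgebra_def sets_sigma_join space_sigma_join sp
    using sets.sigma_sets_subset[of _ M] by auto
qed

lemma measurable_sigma_join: "X \<in> sigma_join G X \<rightarrow>\<^sub>M borel"
  by (rule measurableI) (auto simp: sets_sigma_join space_sigma_join)

text \<open>The disintegration \<open>\<rho> = \<mu> \<cdot> \<alpha>\<close> of the paper, by conditioning first on \<open>G\<close> and \<open>X\<close>.\<close>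

lemma reg_cond_law_kernel_prod:
  fixes X :: "'w \<Rightarrow> 'a::{real_normed_vector,second_countable_topology}" and \<alpha> :: "'w \<Rightarrow> 'b::real_normed_vector"
  assumes M: "prob_space M" and G: "subalgebra M G"
    and XA: "(\<lambda>\<omega>. (X \<omega>, \<alpha> \<omega>)) \<in> M \<rightarrow>\<^sub>M restrict_space borel (UNIV \<times> U)"
    and \<mu>: "reg_cond_law M G borel X \<mu>"
    and a: "reg_cond_law_at M G X (restrict_space borel U) \<alpha> a"
  shows "reg_cond_law M G (restrict_space borel (UNIV \<times> U)) (\<lambda>\<omega>. (X \<omega>, \<alpha> \<omega>))
    (\<lambda>\<omega>. kernel_prod U (\<mu> \<omega>) (a \<omega>))"
proof -
  let ?G = "sigma_join G X" and ?U = "restrict_space borel U"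
  have X: "X \<in> borel_measurable M" and \<mu>m: "\<mu> \<in> G \<rightarrow>\<^sub>M prob_algebra borel"
    using \<mu> by (auto simp: reg_cond_law_def)
  have am: "(\<lambda>(\<omega>, x). a \<omega> x) \<in> G \<Otimes>\<^sub>M borel \<rightarrow>\<^sub>M prob_algebra ?U"
    and ar: "reg_cond_law M ?G ?U \<alpha> (\<lambda>\<omega>. a \<omega> (X \<omega>))"
    using a by (auto simp: reg_cond_law_at_def)
  have spG: "space G = space M" using G by (simp add: subalgebra_def)
  show ?thesis
  proof (rule reg_cond_lawI[OF M G XA kernel_prod_measurable[OF \<mu>m am]])
    fix A B assume A: "A \<in> sets G" and B: "B \<in> sets (restrict_space borel ((UNIV :: 'a set) \<times> U))"
    have Bp: "B \<in> sets (borel \<Otimes>\<^sub>M ?U)" using B by (simp add: sets_restrict_borel_UNIV_Times)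
    \<comment> \<open>The average over \<open>u\<close> at given \<open>(\<omega>, x)\<close>. Its
      joint measurability rests on \<open>a\<close> being a kernel in both variables, and it makes
      the freezing formula for \<open>X\<close> given \<open>G\<close> applicable.\<close>
    define h where "h = (\<lambda>(\<omega>, x). indicator A \<omega> * (\<integral>\<^sup>+u. indicator B (x, u) \<partial>a \<omega> x) :: ennreal)"
    have h: "h \<in> borel_measurable (G \<Otimes>\<^sub>M borel)"
    proof -
      have "(\<lambda>q. (snd (fst q), snd q)) \<in> (G \<Otimes>\<^sub>M borel) \<Otimes>\<^sub>M ?U \<rightarrow>\<^sub>M borel \<Otimes>\<^sub>M ?U" by measurable
      from measurable_compose[OF this borel_measurable_indicator[OF Bp]]
      have "(\<lambda>(p, u). indicator B (snd p, u) :: ennreal) \<in> borel_measurable ((G \<Otimes>\<^sub>M borel) \<Otimes>\<^sub>M ?U)"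
        by (simp add: case_prod_beta')
      from nn_integral_measurable_subprob_algebra2[OF this measurable_prob_algebraD[OF am]]
      have "(\<lambda>p. \<integral>\<^sup>+u. indicator B (snd p, u) \<partial>a (fst p) (snd p)) \<in> borel_measurable (G \<Otimes>\<^sub>M borel)"
        by (simp add: case_prod_beta')
      then show ?thesis unfolding h_def case_prod_beta' using A by measurable
    qed
    \<comment> \<open>This integrand sees \<open>\<omega>\<close> also through
      \<open>X \<omega>\<close>, so it is measurable for \<open>?G\<close> but in general not for
      \<open>G\<close>; hence the second averaging uses the law of \<open>\<alpha>\<close> given
      both.\<close>
    define f where "f = (\<lambda>(\<omega>, u). indicator A \<omega> * indicator B (X \<omega>, u) :: ennreal)"
    have f: "f \<in> borel_measurable (?G \<Otimes>\<^sub>M ?U)"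
    proof -
      have "(\<lambda>p. (X (fst p), snd p)) \<in> ?G \<Otimes>\<^sub>M ?U \<rightarrow>\<^sub>M borel \<Otimes>\<^sub>M ?U"
        using measurable_sigma_join[of X G] by measurable
      from measurable_compose[OF this borel_measurable_indicator[OF Bp]]
      have "(\<lambda>p. indicator B (X (fst p), snd p) :: ennreal) \<in> borel_measurable (?G \<Otimes>\<^sub>M ?U)" .
      moreover have "A \<in> sets ?G" using A by (auto simp: sets_sigma_join)
      ultimately show ?thesis unfolding f_def case_prod_beta' by measurable
    qed
    have aM: "(\<lambda>x. a \<omega> x) \<in> borel \<rightarrow>\<^sub>M prob_algebra ?U" if "\<omega> \<in> space M" for \<omega>
      using measurable_compose[OF measurable_Pair1' am, of \<omega>] that spG by simp
    have \<mu>s: "sets (\<mu> \<omega>) = sets borel" if "\<omega> \<in> space M" for \<omega>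
      using measurable_space[OF \<mu>m, of \<omega>] that spG by (simp add: space_prob_algebra)
    \<comment> \<open>The tower property in integral form: the average over \<open>X\<close> given
      \<open>G\<close> is undone first, then that over \<open>\<alpha>\<close> given
      \<open>G\<close> and \<open>X\<close>.\<close>
    have "(\<integral>\<^sup>+\<omega>. indicator A \<omega> * emeasure (kernel_prod U (\<mu> \<omega>) (a \<omega>)) B \<partial>M) =
        (\<integral>\<^sup>+\<omega>. \<integral>\<^sup>+x. h (\<omega>, x) \<partial>\<mu> \<omega> \<partial>M)"
    proof (rule nn_integral_cong)
      fix \<omega> assume \<omega>: "\<omega> \<in> space M"
      then have \<omega>G: "\<omega> \<in> space G" using spG by simp
      have "B \<in> sets (kernel_prod U (\<mu> \<omega>) (a \<omega>))"
        using measurable_space[OF kernel_prod_measurable[OF \<mu>m am] \<omega>G] B by (simp add: space_prob_algebra)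
      then have "emeasure (kernel_prod U (\<mu> \<omega>) (a \<omega>)) B = (\<integral>\<^sup>+p. indicator B p \<partial>kernel_prod U (\<mu> \<omega>) (a \<omega>))"
        by simp
      also have "\<dots> = (\<integral>\<^sup>+x. \<integral>\<^sup>+u. indicator B (x, u) \<partial>a \<omega> x \<partial>\<mu> \<omega>)"
        using aM[OF \<omega>] B by (intro nn_integral_kernel_prod \<mu>s \<omega>) (auto simp: kernels_def)
      finally have e: "emeasure (kernel_prod U (\<mu> \<omega>) (a \<omega>)) B = \<dots>" .
      show "indicator A \<omega> * emeasure (kernel_prod U (\<mu> \<omega>) (a \<omega>)) B = (\<integral>\<^sup>+x. h (\<omega>, x) \<partial>\<mu> \<omega>)"
        unfolding e h_def by (cases "\<omega> \<in> A") simp_all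
    qed
    also have "\<dots> = (\<integral>\<^sup>+\<omega>. h (\<omega>, X \<omega>) \<partial>M)"
      by (rule nn_integral_reg_cond_law[OF M G \<mu> h, symmetric])
    also have "\<dots> = (\<integral>\<^sup>+\<omega>. \<integral>\<^sup>+u. f (\<omega>, u) \<partial>a \<omega> (X \<omega>) \<partial>M)"
    proof (rule nn_integral_cong)
      fix \<omega>
      show "h (\<omega>, X \<omega>) = (\<integral>\<^sup>+u. f (\<omega>, u) \<partial>a \<omega> (X \<omega>))"
        unfolding h_def f_def by (cases "\<omega> \<in> A") simp_all
    qed
    also have "\<dots> = (\<integral>\<^sup>+\<omega>. f (\<omega>, \<alpha> \<omega>) \<partial>M)"
      by (rule nn_integral_reg_cond_law[OF M subalgebra_sigma_join[OF G X] ar f, symmetric])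
    also have "\<dots> = (\<integral>\<^sup>+\<omega>. indicator {\<omega> \<in> space M. \<omega> \<in> A \<and> (X \<omega>, \<alpha> \<omega>) \<in> B} \<omega> \<partial>M)"
      by (intro nn_integral_cong) (auto simp: f_def indicator_def)
    also have "\<dots> = emeasure M {\<omega> \<in> space M. \<omega> \<in> A \<and> (X \<omega>, \<alpha> \<omega>) \<in> B}"
    proof (rule nn_integral_indicator)
      have "A \<in> sets M" using A G by (auto simp: subalgebra_def)
      then have "A \<inter> ((\<lambda>\<omega>. (X \<omega>, \<alpha> \<omega>)) -` B \<inter> space M) \<in> sets M" using measurable_sets[OF XA B] by simp
      moreover have "{\<omega> \<in> space M. \<omega> \<in> A \<and> (X \<omega>, \<alpha> \<omega>) \<in> B} = A \<inter> ((\<lambda>\<omega>. (X \<omega>, \<alpha> \<omega>)) -` B \<inter> space M)"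
        by auto
      ultimately show "{\<omega> \<in> space M. \<omega> \<in> A \<and> (X \<omega>, \<alpha> \<omega>) \<in> B} \<in> sets M" by simp
    qed
    finally show "emeasure M {\<omega> \<in> space M. \<omega> \<in> A \<and> (X \<omega>, \<alpha> \<omega>) \<in> B} =
      (\<integral>\<^sup>+\<omega>. indicator A \<omega> * emeasure (kernel_prod U (\<mu> \<omega>) (a \<omega>)) B \<partial>M)" by simp
  qed
qed

text \<open>Given \<open>G\<close>, the first slot of \<open>g\<close> acts as a constant, so
  \<open>\<rho> \<omega>\<close> is pushed forward by the section of \<open>g\<close> at
  \<open>\<omega>\<close>. This accommodates the occurrence of \<open>\<rho>\<close> itself inside
  \<open>\<gamma>\<close>.\<close>

lemma reg_cond_law_distr:
  assumes M: "prob_space M" and G: "subalgebra M G" and r: "reg_cond_law M G N V \<rho>"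
    and g: "g \<in> G \<Otimes>\<^sub>M N \<rightarrow>\<^sub>M R"
  shows "reg_cond_law M G R (\<lambda>\<omega>. g (\<omega>, V \<omega>)) (\<lambda>\<omega>. distr (\<rho> \<omega>) R (\<lambda>v. g (\<omega>, v)))"
proof (rule reg_cond_lawI[OF M G])
  have V: "V \<in> M \<rightarrow>\<^sub>M N" and \<rho>: "\<rho> \<in> G \<rightarrow>\<^sub>M prob_algebra N"
    using r by (auto simp: reg_cond_law_def)
  have spG: "space G = space M" using G by (simp add: subalgebra_def)
  have "(\<lambda>\<omega>. \<omega>) \<in> M \<rightarrow>\<^sub>M G" by (rule measurable_from_subalg[OF G]) simp
  then have "(\<lambda>\<omega>. (\<omega>, V \<omega>)) \<in> M \<rightarrow>\<^sub>M G \<Otimes>\<^sub>M N" using V by measurable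
  from measurable_compose[OF this g] show Y: "(\<lambda>\<omega>. g (\<omega>, V \<omega>)) \<in> M \<rightarrow>\<^sub>M R" .
  show "(\<lambda>\<omega>. distr (\<rho> \<omega>) R (\<lambda>v. g (\<omega>, v))) \<in> G \<rightarrow>\<^sub>M prob_algebra R"
    by (rule measurable_distr_prob_space2[OF \<rho>]) (use g in simp)
  fix A B assume A: "A \<in> sets G" and B: "B \<in> sets R"
  define f where "f = (\<lambda>p. indicator A (fst p) * indicator B (g p) :: ennreal)"
  have f: "f \<in> borel_measurable (G \<Otimes>\<^sub>M N)"
    using measurable_compose[OF g borel_measurable_indicator[OF B, where 'b=ennreal]] A
    unfolding f_def by measurable
  have "emeasure M {\<omega> \<in> space M. \<omega> \<in> A \<and> g (\<omega>, V \<omega>) \<in> B} =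
      (\<integral>\<^sup>+\<omega>. indicator {\<omega> \<in> space M. \<omega> \<in> A \<and> g (\<omega>, V \<omega>) \<in> B} \<omega> \<partial>M)"
  proof (rule nn_integral_indicator[symmetric])
    have "A \<in> sets M" using A G by (auto simp: subalgebra_def)
    then have "A \<inter> ((\<lambda>\<omega>. g (\<omega>, V \<omega>)) -` B \<inter> space M) \<in> sets M" using measurable_sets[OF Y B] by simp
    moreover have "{\<omega> \<in> space M. \<omega> \<in> A \<and> g (\<omega>, V \<omega>) \<in> B} = A \<inter> ((\<lambda>\<omega>. g (\<omega>, V \<omega>)) -` B \<inter> space M)"
      by auto
    ultimately show "{\<omega> \<in> space M. \<omega> \<in> A \<and> g (\<omega>, V \<omega>) \<in> B} \<in> sets M" by simp
  qed
  also have "\<dots> = (\<integral>\<^sup>+\<omega>. f (\<omega>, V \<omega>) \<partial>M)"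
    by (intro nn_integral_cong) (auto simp: f_def indicator_def)
  also have "\<dots> = (\<integral>\<^sup>+\<omega>. \<integral>\<^sup>+v. f (\<omega>, v) \<partial>\<rho> \<omega> \<partial>M)"
    by (rule nn_integral_reg_cond_law[OF M G r f])
  also have "\<dots> = (\<integral>\<^sup>+\<omega>. indicator A \<omega> * emeasure (distr (\<rho> \<omega>) R (\<lambda>v. g (\<omega>, v))) B \<partial>M)"
  proof (rule nn_integral_cong)
    fix \<omega> assume \<omega>: "\<omega> \<in> space M"
    have s: "sets (\<rho> \<omega>) = sets N"
      using measurable_space[OF \<rho>, of \<omega>] \<omega> spG by (simp add: space_prob_algebra)
    have gm: "(\<lambda>v. g (\<omega>, v)) \<in> \<rho> \<omega> \<rightarrow>\<^sub>M R"
      using measurable_compose[OF measurable_Pair1' g, of \<omega>] \<omega> spG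
      by (simp add: measurable_cong_sets[OF s refl])
    have "emeasure (distr (\<rho> \<omega>) R (\<lambda>v. g (\<omega>, v))) B = (\<integral>\<^sup>+x. indicator B x \<partial>distr (\<rho> \<omega>) R (\<lambda>v. g (\<omega>, v)))"
      using B by simp
    also have "\<dots> = (\<integral>\<^sup>+v. indicator B (g (\<omega>, v)) \<partial>\<rho> \<omega>)"
      by (rule nn_integral_distr[OF gm]) (use B in simp)
    finally have e: "emeasure (distr (\<rho> \<omega>) R (\<lambda>v. g (\<omega>, v))) B = \<dots>" .
    show "(\<integral>\<^sup>+v. f (\<omega>, v) \<partial>\<rho> \<omega>) = indicator A \<omega> * emeasure (distr (\<rho> \<omega>) R (\<lambda>v. g (\<omega>, v))) B"
      unfolding e f_def by (cases "\<omega> \<in> A") simp_all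
  qed
  finally show "emeasure M {\<omega> \<in> space M. \<omega> \<in> A \<and> g (\<omega>, V \<omega>) \<in> B} =
    (\<integral>\<^sup>+\<omega>. indicator A \<omega> * emeasure (distr (\<rho> \<omega>) R (\<lambda>v. g (\<omega>, v))) B \<partial>M)" .
qed

section \<open>Finitely supported approximation in the Fortet--Mourier distance\<close>

text \<open>A measurable selection of a closest point among \<open>s 0, ..., s m\<close>. The
  recursion reduces measurability to one comparison of distances per step, and ties keep the smaller
  index.\<close>

primrec nearest :: "(nat \<Rightarrow> 'a::metric_space) \<Rightarrow> 'a \<Rightarrow> nat \<Rightarrow> nat" where
  "nearest s w 0 = 0"
| "nearest s w (Suc m) = (if dist w (s (Suc m)) < dist w (s (nearest s w m)) then Suc m else nearest s w m)"

lemma nearest_le: "nearest s w m \<le> m"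
  by (induction m) auto

lemma dist_nearest_le: "i \<le> m \<Longrightarrow> dist w (s (nearest s w m)) \<le> dist w (s i)"
proof (induction m)
  case (Suc m)
  then show ?case by (cases "i = Suc m") auto
qed simp

lemma nearest_measurable:
  assumes "\<And>i. (\<lambda>w. dist w (s i)) \<in> borel_measurable N"
  shows "(\<lambda>w. nearest s w m) \<in> N \<rightarrow>\<^sub>M count_space UNIV"
proof (induction m)
  case (Suc m)
  have "(\<lambda>w. dist w (s (nearest s w m))) \<in> borel_measurable N"
    by (rule measurable_compose_countable[OF assms Suc])
  then have "{w \<in> space N. dist w (s (Suc m)) < dist w (s (nearest s w m))} \<in> sets N"
    using assms by (intro borel_measurable_less)
  then show ?case unfolding nearest.simps by (intro measurable_If Suc) simp_all
qed simp

lemma dist_nearest_tendsto: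
  assumes "\<And>e. e > 0 \<Longrightarrow> \<exists>i. dist w (s i) < e"
  shows "(\<lambda>m. dist w (s (nearest s w m))) \<longlonglongrightarrow> 0"
proof (rule LIMSEQ_I)
  fix e :: real assume "e > 0"
  then obtain i where i: "dist w (s i) < e" using assms by blast
  then have "norm (dist w (s (nearest s w m)) - 0) < e" if "m \<ge> i" for m
    using dist_nearest_le[OF that, of w s] by simp
  then show "\<exists>n0. \<forall>m\<ge>n0. norm (dist w (s (nearest s w m)) - 0) < e" by blast
qed

text \<open>The discrete law with mass \<open>p i\<close> at \<open>s i\<close>. As an image of a
  measure on indices it gives integrals as sums over \<open>i\<close> even when some of the points
  coincide.\<close>

definition finite_law :: "'b::real_normed_vector set \<Rightarrow> (nat \<Rightarrow> 'a::real_normed_vector \<times> 'b) \<Rightarrow> nat \<Rightarrow>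
    (nat \<Rightarrow> real) \<Rightarrow> ('a \<times> 'b) measure" where
  "finite_law U s m p =
     distr (point_measure {..m} (\<lambda>i. ennreal (p i))) (restrict_space borel (UNIV \<times> U)) s"

lemma
  fixes s :: "nat \<Rightarrow> 'a::real_normed_vector \<times> 'b::real_normed_vector"
  assumes s: "range s \<subseteq> UNIV \<times> U" and p: "\<And>i. 0 \<le> p i"
  shows integral_finite_law: "f \<in> borel_measurable (restrict_space borel (UNIV \<times> U)) \<Longrightarrow>
      (\<integral>w. f w \<partial>finite_law U s m p) = (\<Sum>i\<le>m. p i * (f (s i) :: real))"
    and finite_law_P2: "(\<Sum>i\<le>m. p i) = 1 \<Longrightarrow> finite_law U s m p \<in> P2 (UNIV \<times> U)"
proof -
  let ?P = "point_measure {..m} (\<lambda>i. ennreal (p i))" and ?W = "restrict_space borel ((UNIV :: 'a set) \<times> U)"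
  have m: "s \<in> ?P \<rightarrow>\<^sub>M ?W"
    using s by (auto simp: measurable_point_measure_eq1 space_restrict_space)
  show "(\<integral>w. f w \<partial>finite_law U s m p) = (\<Sum>i\<le>m. p i * (f (s i) :: real))"
    if "f \<in> borel_measurable ?W" for f :: "'a \<times> 'b \<Rightarrow> real"
    unfolding finite_law_def integral_distr[OF m that]
    using p by (subst lebesgue_integral_point_measure_finite) auto
  assume "(\<Sum>i\<le>m. p i) = 1"
  then have "prob_space ?P" using p by (intro prob_space_point_measure) (auto simp: sum_ennreal)
  then have "prob_space (finite_law U s m p)"
    unfolding finite_law_def by (rule prob_space.prob_space_distr[OF _ m])
  moreover have "(\<lambda>w. (norm w)\<^sup>2) \<in> borel_measurable ?W"
    by (intro measurable_restrict_space1 borel_measurable_continuous_onI continuous_intros)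
  then have "integrable (finite_law U s m p) (\<lambda>w. (norm w)\<^sup>2)"
    unfolding finite_law_def by (simp add: integrable_distr_eq[OF m] integrable_point_measure_finite)
  ultimately show "finite_law U s m p \<in> P2 (UNIV \<times> U)"
    by (simp add: P2_def finite_law_def)
qed

section \<open>Upper bounds for the Fortet--Mourier distance\<close>

lemma FM_dist_le:
  assumes "\<rho> \<in> P2 (UNIV \<times> U)" "\<rho>' \<in> P2 (UNIV \<times> U)"
    and "\<And>f. f \<in> FM_test \<Longrightarrow> (\<integral>p. f p \<partial>\<rho>) - (\<integral>p. f p \<partial>\<rho>') \<le> c"
  shows "FM_dist U \<rho> \<rho>' \<le> c"
proof -
  have "FM_test \<noteq> ({} :: ('a \<times> 'b \<Rightarrow> real) set)" by (auto simp: FM_test_def intro!: exI[of _ "\<lambda>_. 0"])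
  then show ?thesis using assms by (auto simp: FM_dist_def intro!: cSUP_least)
qed

lemma FM_dist_nonneg: "0 \<le> FM_dist U \<rho> \<rho>'"
  by (rule Metric_space.nonneg[OF Metric_space_FM_dist])

lemma FM_dist_tendsto_zero:
  assumes "\<And>n. FM_dist U (\<pi> n) (\<pi>' n) \<le> e n" "e \<longlonglongrightarrow> 0"
  shows "(\<lambda>n. FM_dist U (\<pi> n) (\<pi>' n)) \<longlonglongrightarrow> 0"
  by (rule Lim_null_comparison[OF always_eventually assms(2)]) (simp add: FM_dist_nonneg assms(1))

lemma FM_test_measurable:
  "f \<in> FM_test \<Longrightarrow> f \<in> borel_measurable (restrict_space borel (UNIV \<times> U))"
  by (intro measurable_restrict_space1 borel_measurable_continuous_onI FM_test_cont)

text \<open>The first 2 comes from the bound 1 on test functions. The factor 2 compares the sum of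
  the component norms with the Euclidean \<open>dist\<close> of pairs, which dominates each
  component.\<close>

lemma FM_test_diff_le:
  assumes "f \<in> FM_test"
  shows "\<bar>f p - f q\<bar> \<le> min 2 (2 * dist p q)"
proof -
  obtain x u y v where pq: "p = (x, u)" "q = (y, v)" by (metis surj_pair)
  have "\<bar>f p - f q\<bar> \<le> norm (x - y) + norm (u - v)" using assms by (auto simp: FM_test_def pq)
  moreover have "norm (x - y) \<le> dist p q" using dist_fst_le[of p q] by (simp add: pq dist_norm)
  moreover have "norm (u - v) \<le> dist p q" using dist_snd_le[of p q] by (simp add: pq dist_norm)
  moreover have "\<bar>f p\<bar> \<le> 1" "\<bar>f q\<bar> \<le> 1" using assms unfolding FM_test_def by blast+
  ultimately show ?thesis by linarith
qed

text \<open>Both laws live on the same points, so only the bound 1 on test functions enters. This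
  makes rounding of the weights harmless.\<close>

lemma FM_dist_finite_law:
  assumes s: "range s \<subseteq> UNIV \<times> U" and p: "\<And>i. 0 \<le> p i" "(\<Sum>i\<le>m. p i) = 1"
    and q: "\<And>i. 0 \<le> q i" "(\<Sum>i\<le>m. q i) = 1"
  shows "FM_dist U (finite_law U s m p) (finite_law U s m q) \<le> (\<Sum>i\<le>m. \<bar>p i - q i\<bar>)"
proof (rule FM_dist_le[OF finite_law_P2[OF s p] finite_law_P2[OF s q]])
  fix f :: "'a \<times> 'b \<Rightarrow> real" assume f: "f \<in> FM_test"
  have "(\<Sum>i\<le>m. p i * f (s i)) - (\<Sum>i\<le>m. q i * f (s i)) = (\<Sum>i\<le>m. (p i - q i) * f (s i))"
    by (simp add: sum_subtractf algebra_simps)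
  also have "\<dots> \<le> (\<Sum>i\<le>m. \<bar>p i - q i\<bar>)"
  proof (rule sum_mono)
    fix i
    have "\<bar>f (s i)\<bar> \<le> 1" using f unfolding FM_test_def by blast
    then have "\<bar>(p i - q i) * f (s i)\<bar> \<le> \<bar>p i - q i\<bar>" by (simp add: abs_mult mult_left_le)
    then show "(p i - q i) * f (s i) \<le> \<bar>p i - q i\<bar>" by linarith
  qed
  finally show "(\<integral>w. f w \<partial>finite_law U s m p) - (\<integral>w. f w \<partial>finite_law U s m q) \<le> (\<Sum>i\<le>m. \<bar>p i - q i\<bar>)"
    by (simp add: integral_finite_law[OF s p(1) FM_test_measurable[OF f]]
      integral_finite_law[OF s q(1) FM_test_measurable[OF f]])
qed

text \<open>The mass of the Voronoi cell of \<open>s i\<close> among \<open>s 0, ..., s m\<close>.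
  With these weights \<open>finite_law\<close> is the image of \<open>\<rho>\<close> under the map
  to the selected nearest point.\<close>

definition nearest_weight :: "(nat \<Rightarrow> 'a::metric_space) \<Rightarrow> 'a measure \<Rightarrow> nat \<Rightarrow> nat \<Rightarrow> real" where
  "nearest_weight s \<rho> m i = measure \<rho> {w \<in> space \<rho>. nearest s w m = i}"

text \<open>Coupling \<open>w\<close> with its nearest point bounds the difference of integrals by
  the mean of \<open>e m\<close>, the same for all test functions. Density sends \<open>e m\<close>
  to 0 pointwise, and its truncation at 2 permits dominated convergence.\<close>

lemma
  fixes \<rho> :: "('a::real_normed_vector \<times> 'b::real_normed_vector) measure"
  assumes s: "range s \<subseteq> UNIV \<times> U" and dense: "\<And>w e. w \<in> UNIV \<times> U \<Longrightarrow> e > 0 \<Longrightarrow> \<exists>i. dist w (s i) < e"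
    and \<rho>: "\<rho> \<in> P2 (UNIV \<times> U)"
  shows sum_nearest_weight: "(\<Sum>i\<le>m. nearest_weight s \<rho> m i) = 1"
    and finite_law_nearest_tendsto:
      "(\<lambda>m. FM_dist U (finite_law U s m (nearest_weight s \<rho> m)) \<rho>) \<longlonglongrightarrow> 0"
proof -
  let ?W = "restrict_space borel ((UNIV :: 'a set) \<times> U)" and ?p = "nearest_weight s \<rho>"
  interpret prob_space \<rho> using \<rho> by (simp add: P2_def)
  have sets: "sets \<rho> = sets ?W" using \<rho> by (simp add: P2_def)
  have space: "space \<rho> = UNIV \<times> U" using sets_eq_imp_space_eq[OF sets] by (simp add: space_restrict_space)
  have d: "(\<lambda>w. dist w (s i)) \<in> borel_measurable \<rho>" for i
    unfolding measurable_cong_sets[OF sets refl]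
    by (intro measurable_restrict_space1 borel_measurable_continuous_onI continuous_intros)
  note [measurable] = nearest_measurable[where s=s and N=\<rho>, OF d]
  have [measurable]: "{w \<in> space \<rho>. nearest s w m = i} \<in> sets \<rho>" for m i by measurable
  have pos: "0 \<le> ?p m i" for m i by (simp add: nearest_weight_def)
  \<comment> \<open>Change of variables to indices: constant \<open>F\<close> gives the total mass,
    and \<open>F i = f (s i)\<close> the integral against the discrete law.\<close>
  have mix: "(\<Sum>i\<le>m. ?p m i * F i) = (\<integral>w. F (nearest s w m) \<partial>\<rho>)" for m and F :: "nat \<Rightarrow> real"
  proof -
    have "(\<Sum>i\<le>m. ?p m i * F i) = (\<Sum>i\<le>m. \<integral>w. indicator {w \<in> space \<rho>. nearest s w m = i} w * F i \<partial>\<rho>)"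
      by (simp add: nearest_weight_def Int_absorb2 subset_eq)
    also have "\<dots> = (\<integral>w. (\<Sum>i\<le>m. indicator {w \<in> space \<rho>. nearest s w m = i} w * F i) \<partial>\<rho>)"
      by (rule Bochner_Integration.integral_sum[symmetric]) (simp add: less_top[symmetric])
    also have "\<dots> = (\<integral>w. F (nearest s w m) \<partial>\<rho>)"
    proof (rule Bochner_Integration.integral_cong[OF refl])
      fix w assume "w \<in> space \<rho>"
      then have "(\<Sum>i\<le>m. indicator {w \<in> space \<rho>. nearest s w m = i} w * F i) =
          (\<Sum>i\<le>m. if i = nearest s w m then F i else 0)"
        by (intro sum.cong) (auto simp: indicator_def)
      also have "\<dots> = F (nearest s w m)" using nearest_le[of s w m] by simp
      finally show "(\<Sum>i\<le>m. indicator {w \<in> space \<rho>. nearest s w m = i} w * F i) = F (nearest s w m)" .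
    qed
    finally show ?thesis .
  qed
  show sum1: "(\<Sum>i\<le>m. ?p m i) = 1" for m using mix[of m "\<lambda>_. 1"] by (simp add: prob_space)
  define e where "e m w = min 2 (2 * dist w (s (nearest s w m)))" for m w
  have em: "e m \<in> borel_measurable \<rho>" for m
    using measurable_compose_countable[OF d nearest_measurable[where s=s and N=\<rho>, OF d]]
    unfolding e_def by measurable
  have ei: "integrable \<rho> (e m)" for m
    by (rule integrable_const_bound[of _ 2]) (auto simp: em, auto simp: e_def)
  have le: "FM_dist U (finite_law U s m (?p m)) \<rho> \<le> (\<integral>w. e m w \<partial>\<rho>)" for m
  proof (rule FM_dist_le[OF finite_law_P2[OF s pos sum1] \<rho>])
    fix f :: "'a \<times> 'b \<Rightarrow> real" assume f: "f \<in> FM_test"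
    have fi: "integrable \<rho> f" by (rule FM_test_integral(1)[OF f \<rho>])
    have fs: "integrable \<rho> (\<lambda>w. f (s (nearest s w m)))"
    proof (rule integrable_const_bound[of _ 1])
      show "AE w in \<rho>. norm (f (s (nearest s w m))) \<le> 1"
        using f unfolding FM_test_def mem_Collect_eq by (intro AE_I2) (metis real_norm_def)
    qed measurable
    have "(\<integral>w. f w \<partial>finite_law U s m (?p m)) - (\<integral>w. f w \<partial>\<rho>) = (\<integral>w. f (s (nearest s w m)) - f w \<partial>\<rho>)"
      by (simp add: integral_finite_law[OF s pos FM_test_measurable[OF f]] mix fi fs)
    also have "\<dots> \<le> (\<integral>w. e m w \<partial>\<rho>)"
    proof (rule integral_mono)
      show "f (s (nearest s w m)) - f w \<le> e m w" for w
        using FM_test_diff_le[OF f, of w "s (nearest s w m)"] unfolding e_def by linarith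
    qed (simp_all add: fi fs ei)
    finally show "(\<integral>w. f w \<partial>finite_law U s m (?p m)) - (\<integral>w. f w \<partial>\<rho>) \<le> (\<integral>w. e m w \<partial>\<rho>)" .
  qed
  have "(\<lambda>m. \<integral>w. e m w \<partial>\<rho>) \<longlonglongrightarrow> (\<integral>w. 0 \<partial>\<rho>)"
  proof (rule integral_dominated_convergence[where w="\<lambda>_. 2"])
    show "AE w in \<rho>. (\<lambda>m. e m w) \<longlonglongrightarrow> 0"
    proof (rule AE_I2)
      fix w assume "w \<in> space \<rho>"
      then have "(\<lambda>m. dist w (s (nearest s w m))) \<longlonglongrightarrow> 0"
        using dense by (intro dist_nearest_tendsto) (simp add: space)
      then have "(\<lambda>m. min 2 (2 * dist w (s (nearest s w m)))) \<longlonglongrightarrow> min 2 (2 * 0)"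
        by (intro tendsto_min tendsto_const tendsto_mult)
      then show "(\<lambda>m. e m w) \<longlonglongrightarrow> 0" by (simp add: e_def)
    qed
  qed (auto simp: em, auto simp: e_def)
  then show "(\<lambda>m. FM_dist U (finite_law U s m (?p m)) \<rho>) \<longlonglongrightarrow> 0"
    by (intro FM_dist_tendsto_zero[OF le]) simp
qed

text \<open>Packs finitely many values into a single map to a countable type, which can then act as
  the index in \<open>measurable_compose_countable\<close>.\<close>

lemma measurable_map_count_space:
  fixes f :: "'i \<Rightarrow> 'w \<Rightarrow> 'c::countable"
  assumes "\<And>i. f i \<in> G \<rightarrow>\<^sub>M count_space UNIV"
  shows "(\<lambda>\<omega>. map (\<lambda>i. f i \<omega>) xs) \<in> G \<rightarrow>\<^sub>M count_space UNIV"
proof (induction xs)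
  case (Cons x xs)
  have "(\<lambda>\<omega>. c # map (\<lambda>i. f i \<omega>) xs) \<in> G \<rightarrow>\<^sub>M count_space UNIV" for c
    by (rule measurable_compose[OF Cons]) simp
  from measurable_compose_countable[OF this assms[of x]] show ?case by simp
qed simp

text \<open>
  Adding 1 keeps the weights positive with sum 1 for every list, also where \<open>c ! i\<close> is
  unspecified because the list is too short.
\<close>

definition round_weight :: "nat \<Rightarrow> nat list \<Rightarrow> nat \<Rightarrow> real" where
  "round_weight m c i = (real (c ! i) + 1) / (\<Sum>j\<le>m. real (c ! j) + 1)"

lemma round_weight_nonneg: "0 \<le> round_weight m c i"
  by (auto simp: round_weight_def intro!: divide_nonneg_nonneg sum_nonneg)

lemma sum_round_weight: "(\<Sum>i\<le>m. round_weight m c i) = 1"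
proof -
  have "0 < (\<Sum>j\<le>m. real (c ! j) + 1)" by (intro sum_pos) auto
  then show ?thesis unfolding round_weight_def by (simp flip: sum_divide_distrib)
qed

text \<open>Before normalisation the weight divided by K lies between \<open>p i\<close> and
  \<open>p i\<close> + 1/K. Hence it converges, the sum of these quotients tends to 1, and the
  common factor 1/K cancels.\<close>

lemma round_weight_tendsto:
  assumes p: "\<And>i. 0 \<le> p i" "(\<Sum>i\<le>m. p i) = 1" and i: "i \<le> m"
  shows "(\<lambda>K. round_weight m (map (\<lambda>i. nat \<lfloor>real K * p i\<rfloor>) [0..<Suc m]) i) \<longlonglongrightarrow> p i"
proof -
  define r where "r K i = (real (nat \<lfloor>real K * p i\<rfloor>) + 1) / real K" for K i
  have r: "(\<lambda>K. r K i) \<longlonglongrightarrow> p i" for i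
  proof (rule tendsto_sandwich)
    have fl: "real K * p i \<le> real (nat \<lfloor>real K * p i\<rfloor>) + 1" "real (nat \<lfloor>real K * p i\<rfloor>) \<le> real K * p i" for K
      using p(1)[of i] by (simp_all add: of_nat_nat zero_le_floor)
    show "eventually (\<lambda>K. p i \<le> r K i) sequentially"
      using eventually_gt_at_top[of 0]
      by eventually_elim (use fl in \<open>simp add: r_def field_simps\<close>)
    show "eventually (\<lambda>K. r K i \<le> p i + 1 / real K) sequentially"
      using eventually_gt_at_top[of 0]
      by eventually_elim (use fl in \<open>simp add: r_def field_simps\<close>)
    show "(\<lambda>K. p i + 1 / real K) \<longlonglongrightarrow> p i"
      using tendsto_add[OF tendsto_const lim_1_over_n, of "p i"] by simp
  qed simp
  have "(\<lambda>K. r K i / (\<Sum>j\<le>m. r K j)) \<longlonglongrightarrow> p i / (\<Sum>j\<le>m. p j)"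
    by (intro tendsto_divide tendsto_sum r) (simp add: p(2))
  then have "(\<lambda>K. r K i / (\<Sum>j\<le>m. r K j)) \<longlonglongrightarrow> p i" by (simp add: p(2))
  then show ?thesis
  proof (rule Lim_transform_eventually)
    show "eventually (\<lambda>K. r K i / (\<Sum>j\<le>m. r K j) =
        round_weight m (map (\<lambda>i. nat \<lfloor>real K * p i\<rfloor>) [0..<Suc m]) i) sequentially"
      \<comment> \<open>At \<open>K = 0\<close> every \<open>r K i\<close> is 0 by the convention
        for division, so the quotients agree only for positive \<open>K\<close>.\<close>
      using eventually_gt_at_top[of 0]
    proof eventually_elim
      case (elim K)
      have "map (\<lambda>i. nat \<lfloor>real K * p i\<rfloor>) [0..<Suc m] ! j = nat \<lfloor>real K * p j\<rfloor>" if "j \<le> m" for j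
        using that by (simp add: nth_append del: upt_Suc)
      moreover have "(\<Sum>j\<le>m. r K j) = (\<Sum>j\<le>m. real (nat \<lfloor>real K * p j\<rfloor>) + 1) / real K"
        unfolding r_def by (rule sum_divide_distrib[symmetric])
      ultimately show ?case using elim i unfolding round_weight_def r_def by (simp del: upt_Suc)
    qed
  qed
qed

text \<open>
  Measurability of \<open>\<rho>\<close> only controls the evaluations on Borel sets.  Replacing \<open>\<rho> \<omega>\<close> by the
  law of the nearest point among \<open>s 0, \<dots>, s m\<close>, and rounding its weights to rationals, gives a
  map with countably many values; the Lipschitz bound carries measurability to the limit.
\<close>

lemma measurable_FM_Lipschitz:
  fixes \<rho> :: "'w \<Rightarrow> ('a::real_normed_vector \<times> 'b::real_normed_vector) measure"
    and h :: "('a \<times> 'b) measure \<Rightarrow> 'c \<Rightarrow> 'd::real_normed_vector" and s :: "nat \<Rightarrow> 'a \<times> 'b"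
  assumes s: "range s \<subseteq> UNIV \<times> U" and dense: "\<And>w e. w \<in> UNIV \<times> U \<Longrightarrow> e > 0 \<Longrightarrow> \<exists>i. dist w (s i) < e"
    and \<rho>: "\<rho> \<in> G \<rightarrow>\<^sub>M prob_algebra (restrict_space borel (UNIV \<times> U))"
    and P2: "\<And>\<omega>. \<omega> \<in> space G \<Longrightarrow> \<rho> \<omega> \<in> P2 (UNIV \<times> U)"
    and meas: "\<And>\<pi>. \<pi> \<in> P2 (UNIV \<times> U) \<Longrightarrow> h \<pi> \<in> borel_measurable N"
    and Lip: "\<And>\<pi> \<pi>' v. \<pi> \<in> P2 (UNIV \<times> U) \<Longrightarrow> \<pi>' \<in> P2 (UNIV \<times> U) \<Longrightarrow> v \<in> space N \<Longrightarrow>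
      norm (h \<pi> v - h \<pi>' v) \<le> L * FM_dist U \<pi> \<pi>'"
  shows "(\<lambda>x. h (\<rho> (fst x)) (snd x)) \<in> borel_measurable (G \<Otimes>\<^sub>M N)"
proof -
  let ?W = "restrict_space borel ((UNIV :: 'a set) \<times> U)"
  \<comment> \<open>For fixed \<open>v\<close>, convergence of laws in the Fortet--Mourier distance
    passes through \<open>h\<close>; both limits below are instances.\<close>
  have lim: "(\<lambda>n. h (\<pi> n) v) \<longlonglongrightarrow> h \<pi>' v"
    if "\<And>n. \<pi> n \<in> P2 (UNIV \<times> U)" "\<pi>' \<in> P2 (UNIV \<times> U)" "v \<in> space N" "(\<lambda>n. FM_dist U (\<pi> n) \<pi>') \<longlonglongrightarrow> 0" for \<pi> \<pi>' v
  proof -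
    have "(\<lambda>n. L * FM_dist U (\<pi> n) \<pi>') \<longlonglongrightarrow> 0"
      using tendsto_mult_right_zero[OF that(4)] .
    moreover have "eventually (\<lambda>n. norm (h (\<pi> n) v - h \<pi>' v) \<le> L * FM_dist U (\<pi> n) \<pi>') sequentially"
      using Lip[OF that(1-3)] by simp
    ultimately have "(\<lambda>n. h (\<pi> n) v - h \<pi>' v) \<longlonglongrightarrow> 0" by (rule Lim_null_comparison[rotated])
    then show ?thesis by (simp add: LIM_zero_iff)
  qed
  have dW: "(\<lambda>w. dist w (s i)) \<in> borel_measurable ?W" for i
    by (intro measurable_restrict_space1 borel_measurable_continuous_onI continuous_intros)
  define p where "p m \<omega> = nearest_weight s (\<rho> \<omega>) m" for m \<omega>
  define c where "c K m \<omega> = map (\<lambda>i. nat \<lfloor>real K * p m \<omega> i\<rfloor>) [0..<Suc m]" for K m \<omega>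
  have pos: "0 \<le> p m \<omega> i" for m \<omega> i by (simp add: p_def nearest_weight_def)
  have sum1: "(\<Sum>i\<le>m. p m \<omega> i) = 1" if "\<omega> \<in> space G" for m \<omega>
    unfolding p_def by (rule sum_nearest_weight[OF s dense P2[OF that]])
  \<comment> \<open>Here the kernel property of \<open>\<rho>\<close> enters: each weight is an
    evaluation on one fixed Borel set. The set is written with \<open>space ?W\<close>, since
    \<open>space (\<rho> \<omega>)\<close> formally varies with \<open>\<omega>\<close>.\<close>
  have pm: "(\<lambda>\<omega>. p m \<omega> i) \<in> borel_measurable G" for m i
  proof -
    have "{w \<in> space ?W. nearest s w m = i} \<in> sets ?W"
      using nearest_measurable[where s=s and N="?W", OF dW] by measurable
    then have "(\<lambda>\<omega>. measure (\<rho> \<omega>) {w \<in> space ?W. nearest s w m = i}) \<in> borel_measurable G"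
      using measurable_prob_algebraD[OF \<rho>] by measurable
    moreover have "p m \<omega> i = measure (\<rho> \<omega>) {w \<in> space ?W. nearest s w m = i}" if "\<omega> \<in> space G" for \<omega>
    proof -
      have "space (\<rho> \<omega>) = space ?W" using P2[OF that] by (intro sets_eq_imp_space_eq) (simp add: P2_def)
      then show ?thesis unfolding p_def nearest_weight_def by (rule arg_cong)
    qed
    ultimately show ?thesis by (simp cong: measurable_cong)
  qed
  have cm: "c K m \<in> G \<rightarrow>\<^sub>M count_space UNIV" for K m
    unfolding c_def by (rule measurable_map_count_space) (use pm in measurable)
  have fP2: "finite_law U s m (round_weight m c) \<in> P2 (UNIV \<times> U)" for m c
    by (rule finite_law_P2[OF s round_weight_nonneg sum_round_weight])
  \<comment> \<open>Lists of naturals are countable and each fixes one law, so measurability of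
    \<open>h\<close> at single laws suffices.\<close>
  have rounded: "(\<lambda>x. h (finite_law U s m (round_weight m (c K m (fst x)))) (snd x)) \<in> borel_measurable (G \<Otimes>\<^sub>M N)" for K m
  proof (rule measurable_compose_countable)
    show "(\<lambda>x. h (finite_law U s m (round_weight m l)) (snd x)) \<in> borel_measurable (G \<Otimes>\<^sub>M N)" for l
      by (rule measurable_compose[OF measurable_snd meas[OF fP2]])
    show "(\<lambda>x. c K m (fst x)) \<in> G \<Otimes>\<^sub>M N \<rightarrow>\<^sub>M count_space UNIV"
      by (rule measurable_compose[OF measurable_fst cm])
  qed
  \<comment> \<open>The rounding is refined at fixed \<open>m\<close>, with \<open>K\<close> tending
    to infinity; only then does \<open>m\<close> grow.\<close>
  have finite: "(\<lambda>x. h (finite_law U s m (p m (fst x))) (snd x)) \<in> borel_measurable (G \<Otimes>\<^sub>M N)" for m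
  proof (rule borel_measurable_LIMSEQ_metric[OF rounded])
    fix x assume x: "x \<in> space (G \<Otimes>\<^sub>M N)"
    then have \<omega>: "fst x \<in> space G" and v: "snd x \<in> space N" by (auto simp: space_pair_measure)
    show "(\<lambda>K. h (finite_law U s m (round_weight m (c K m (fst x)))) (snd x)) \<longlonglongrightarrow>
      h (finite_law U s m (p m (fst x))) (snd x)"
    proof (rule lim[OF fP2 finite_law_P2[OF s pos sum1[OF \<omega>]] v])
      have "(\<lambda>K. \<Sum>i\<le>m. \<bar>round_weight m (c K m (fst x)) i - p m (fst x) i\<bar>) \<longlonglongrightarrow> (\<Sum>i\<le>m. 0)"
      proof (rule tendsto_sum)
        fix i assume "i \<in> {..m}"
        then have "(\<lambda>K. round_weight m (c K m (fst x)) i) \<longlonglongrightarrow> p m (fst x) i"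
          unfolding c_def using round_weight_tendsto[OF pos sum1[OF \<omega>]] by simp
        then show "(\<lambda>K. \<bar>round_weight m (c K m (fst x)) i - p m (fst x) i\<bar>) \<longlonglongrightarrow> 0"
          by (intro tendsto_rabs_zero) (simp add: LIM_zero)
      qed
      then show "(\<lambda>K. FM_dist U (finite_law U s m (round_weight m (c K m (fst x))))
          (finite_law U s m (p m (fst x)))) \<longlonglongrightarrow> 0"
        by (intro FM_dist_tendsto_zero[OF
            FM_dist_finite_law[OF s round_weight_nonneg sum_round_weight pos sum1[OF \<omega>]]]) simp
    qed
  qed
  show ?thesis
  proof (rule borel_measurable_LIMSEQ_metric[OF finite])
    fix x assume x: "x \<in> space (G \<Otimes>\<^sub>M N)"
    then have \<omega>: "fst x \<in> space G" and v: "snd x \<in> space N" by (auto simp: space_pair_measure)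
    show "(\<lambda>m. h (finite_law U s m (p m (fst x))) (snd x)) \<longlonglongrightarrow> h (\<rho> (fst x)) (snd x)"
      by (rule lim[OF finite_law_P2[OF s pos sum1[OF \<omega>]] P2[OF \<omega>] v])
        (unfold p_def, rule finite_law_nearest_tendsto[OF s dense P2[OF \<omega>]])
  qed
qed

section \<open>The conditional law of the jump\<close>

lemma M2_nonneg: "0 \<le> M2 \<rho>"
  unfolding M2_def by (intro real_sqrt_ge_zero Bochner_Integration.integral_nonneg) (simp add: case_prod_beta')

theorem lemma4p2:
  fixes U :: "'b::banach set" and Z :: "'z measure" and L :: real
    and \<gamma> :: "real ^ 'n \<Rightarrow> ((real ^ 'n) \<times> 'b) measure \<Rightarrow> 'b \<Rightarrow> 'z \<Rightarrow> real ^ 'n"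
  assumes U: "compact U"
    and gamma_cont: "\<And>z. z \<in> space Z \<Longrightarrow>
      continuous_map (prod_topology euclidean (prod_topology (P2_topology U) (top_of_set U)))
        euclidean (\<lambda>(x, \<rho>, u). \<gamma> x \<rho> u z)"
    and gamma_meas: "(\<lambda>(x, \<rho>, u, z). \<gamma> x \<rho> u z) \<in>
      borel \<Otimes>\<^sub>M P2_borel U \<Otimes>\<^sub>M restrict_space borel U \<Otimes>\<^sub>M Z \<rightarrow>\<^sub>M borel"
    and gamma_Lip: "\<And>x x' \<rho> \<rho>' u z.
      \<rho> \<in> P2 (UNIV \<times> U) \<Longrightarrow> \<rho>' \<in> P2 (UNIV \<times> U) \<Longrightarrow> u \<in> U \<Longrightarrow> z \<in> space Z \<Longrightarrow>
      norm (\<gamma> x' \<rho>' u z - \<gamma> x \<rho> u z) \<le> L * (norm (x - x') + FM_dist U \<rho> \<rho>')"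
    and gamma_growth: "\<And>x \<rho> u z.
      \<rho> \<in> P2 (UNIV \<times> U) \<Longrightarrow> u \<in> U \<Longrightarrow> z \<in> space Z \<Longrightarrow>
      norm (\<gamma> x \<rho> u z) \<le> L * (1 + norm x + M2 \<rho>)"
  shows "(\<forall>\<mu>\<in>P2 UNIV. \<forall>k\<in>kernels U. \<forall>z\<in>space Z. \<forall>\<nu>\<in>P2 UNIV. I_adj \<gamma> U \<mu> k z \<nu> \<in> P2 UNIV)
    \<and> (\<forall>(M :: 'w measure) G X \<alpha> \<rho> \<mu> a. \<forall>z\<in>space Z.
         prob_space M \<longrightarrow> subalgebra M G \<longrightarrow>
         (\<lambda>\<omega>. (X \<omega>, \<alpha> \<omega>)) \<in> M \<rightarrow>\<^sub>M restrict_space borel (UNIV \<times> U) \<longrightarrow>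
         integrable M (\<lambda>\<omega>. (norm (X \<omega>))\<^sup>2) \<longrightarrow>
         reg_cond_law M G (restrict_space borel (UNIV \<times> U)) (\<lambda>\<omega>. (X \<omega>, \<alpha> \<omega>)) \<rho> \<longrightarrow>
         (\<forall>\<omega>\<in>space M. \<rho> \<omega> \<in> P2 (UNIV \<times> U)) \<longrightarrow>
         reg_cond_law M G borel X \<mu> \<longrightarrow>
         reg_cond_law_at M G X (restrict_space borel U) \<alpha> a \<longrightarrow>
         (let Y = (\<lambda>\<omega>. X \<omega> + \<gamma> (X \<omega>) (\<rho> \<omega>) (\<alpha> \<omega>) z) in
           (\<exists>\<kappa>. reg_cond_law M G borel Y \<kappa>) \<and>
           (\<forall>\<kappa>. reg_cond_law M G borel Y \<kappa> \<longrightarrow>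
              (AE \<omega> in M. I_adj \<gamma> U (\<mu> \<omega>) (a \<omega>) z (\<mu> \<omega>) = \<kappa> \<omega>))))"
proof (intro conjI ballI allI impI)
  let ?W = "restrict_space borel ((UNIV :: (real ^ 'n) set) \<times> U)"
  \<comment> \<open>With the law frozen at a point of \<open>P2_borel U\<close>, only joint
    measurability in the remaining variables is extracted from \<open>gamma_meas\<close>.\<close>
  have gamma_W: "(\<lambda>p. \<gamma> (fst p) \<pi> (snd p) z) \<in> borel_measurable ?W"
    if \<pi>: "\<pi> \<in> P2 (UNIV \<times> U)" and z: "z \<in> space Z" for \<pi> z
  proof -
    have "\<pi> \<in> space (P2_borel U)" using \<pi> unfolding P2_borel_def by (simp add: space_measure_of_conv)
    then have "(\<lambda>p. (fst p, \<pi>, snd p, z)) \<in> borel \<Otimes>\<^sub>M restrict_space borel U \<rightarrow>\<^sub>M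
        borel \<Otimes>\<^sub>M P2_borel U \<Otimes>\<^sub>M restrict_space borel U \<Otimes>\<^sub>M Z"
      using z by measurable
    from measurable_compose[OF this gamma_meas] show ?thesis
      by (simp add: measurable_cong_sets[OF sets_restrict_borel_UNIV_Times refl])
  qed
  have fst_W: "fst \<in> borel_measurable ?W"
    by (intro measurable_restrict_space1 borel_measurable_continuous_onI continuous_intros)
  \<comment> \<open>The premise concerns \<open>kernel_prod U \<mu> k\<close> rather than
    \<open>\<mu>\<close>: in the conditional part its membership in \<open>P2\<close> is inherited
    from \<open>\<rho> \<omega>\<close> through their almost sure equality.\<close>
  have I_adj: "I_adj \<gamma> U \<mu> k z \<nu> =
      distr (kernel_prod U \<nu> k) borel (\<lambda>p. fst p + \<gamma> (fst p) (kernel_prod U \<mu> k) (snd p) z)"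
    if "kernel_prod U \<mu> k \<in> P2 (UNIV \<times> U)" "k \<in> kernels U" "z \<in> space Z" "\<nu> \<in> space (prob_algebra borel)"
    for \<mu> k z \<nu>
    using adjoint_meas_kernel[OF that(4,2), of "\<lambda>p. fst p + \<gamma> (fst p) (kernel_prod U \<mu> k) (snd p) z"]
      borel_measurable_add[OF fst_W gamma_W[OF that(1,3)]]
    by (simp add: I_adj_def I_op_def[abs_def])
  {
    fix \<mu> \<nu> :: "(real ^ 'n) measure" and k :: "real ^ 'n \<Rightarrow> 'b measure" and z
    assume \<mu>: "\<mu> \<in> P2 UNIV" and k: "k \<in> kernels U" and z: "z \<in> space Z" and \<nu>: "\<nu> \<in> P2 UNIV"
    let ?\<pi> = "kernel_prod U \<mu> k" and ?\<kappa> = "kernel_prod U \<nu> k"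
    let ?g = "\<lambda>p. fst p + \<gamma> (fst p) ?\<pi> (snd p) z"
    have \<pi>: "?\<pi> \<in> P2 (UNIV \<times> U)" and \<kappa>: "?\<kappa> \<in> P2 (UNIV \<times> U)"
      using kernel_prod_P2 \<mu> \<nu> k compact_imp_bounded[OF U] by blast+
    then interpret prob_space ?\<kappa> by (simp add: P2_def)
    have \<kappa>s: "sets ?\<kappa> = sets ?W" and \<kappa>i: "integrable ?\<kappa> (\<lambda>p. (norm p)\<^sup>2)" using \<kappa> by (auto simp: P2_def)
    have g: "?g \<in> borel_measurable ?\<kappa>"
      using borel_measurable_add[OF fst_W gamma_W[OF \<pi> z]] by (simp add: measurable_cong_sets[OF \<kappa>s refl])
    \<comment> \<open>Linear growth gives \<open>norm (?g p) \<le> A + B * norm p\<close>; the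
      summand 1 in \<open>B\<close> stems from the term \<open>fst p\<close>. The absolute value
      allows for either sign of \<open>L\<close>.\<close>
    define A where "A = \<bar>L\<bar> * (1 + M2 ?\<pi>)"
    define B where "B = 1 + \<bar>L\<bar>"
    have "integrable ?\<kappa> (\<lambda>p. (norm (?g p))\<^sup>2)"
    proof (rule Bochner_Integration.integrable_bound)
      show "integrable ?\<kappa> (\<lambda>p. 2 * A\<^sup>2 + 2 * B\<^sup>2 * (norm p)\<^sup>2)" using \<kappa>i by simp
      show "(\<lambda>p. (norm (?g p))\<^sup>2) \<in> borel_measurable ?\<kappa>" using g by measurable
      show "AE p in ?\<kappa>. norm ((norm (?g p))\<^sup>2) \<le> norm (2 * A\<^sup>2 + 2 * B\<^sup>2 * (norm p)\<^sup>2)"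
      proof (rule AE_I2)
        fix p assume "p \<in> space ?\<kappa>"
        then have "p \<in> UNIV \<times> U" using sets_eq_imp_space_eq[OF \<kappa>s] by (simp add: space_restrict_space)
        then have "snd p \<in> U" by (simp add: mem_Times_iff)
        from gamma_growth[OF \<pi> this z, of "fst p"]
        have "norm (\<gamma> (fst p) ?\<pi> (snd p) z) \<le> L * (1 + norm (fst p) + M2 ?\<pi>)" .
        also have "\<dots> \<le> \<bar>L\<bar> * (1 + norm (fst p) + M2 ?\<pi>)"
          by (intro mult_right_mono) (simp_all add: M2_nonneg)
        finally have "norm (?g p) \<le> norm (fst p) + \<bar>L\<bar> * (1 + norm (fst p) + M2 ?\<pi>)"
          by (intro norm_triangle_le) simp
        also have "\<dots> = A + B * norm (fst p)" by (simp add: A_def B_def algebra_simps)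
        also have "\<dots> \<le> A + B * norm p"
          using norm_fst_le[of "fst p" "snd p"] by (simp add: B_def mult_left_mono)
        finally have "(norm (?g p))\<^sup>2 \<le> (A + B * norm p)\<^sup>2" by (intro power_mono) auto
        also have "\<dots> \<le> 2 * A\<^sup>2 + 2 * B\<^sup>2 * (norm p)\<^sup>2"
          using sum_squares_bound[of A "B * norm p"] by (simp add: power2_sum power_mult_distrib)
        finally show "norm ((norm (?g p))\<^sup>2) \<le> norm (2 * A\<^sup>2 + 2 * B\<^sup>2 * (norm p)\<^sup>2)" by simp
      qed
    qed
    then have "distr ?\<kappa> borel ?g \<in> P2 UNIV"
      using prob_space_distr[OF g] by (simp add: P2_def integrable_distr_eq[OF g])
    moreover have "\<nu> \<in> space (prob_algebra borel)" using \<nu> by (simp add: P2_def space_prob_algebra)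
    ultimately show "I_adj \<gamma> U \<mu> k z \<nu> \<in> P2 UNIV" by (simp add: I_adj[OF \<pi> k z])
  }
  fix M :: "'w measure" and G X \<alpha> \<rho> \<mu> a z
  assume z: "z \<in> space Z" and M: "prob_space M" and G: "subalgebra M G"
    and XA: "(\<lambda>\<omega>. (X \<omega>, \<alpha> \<omega>)) \<in> M \<rightarrow>\<^sub>M ?W"
    and \<rho>: "reg_cond_law M G ?W (\<lambda>\<omega>. (X \<omega>, \<alpha> \<omega>)) \<rho>"
    and \<rho>P2: "\<forall>\<omega>\<in>space M. \<rho> \<omega> \<in> P2 (UNIV \<times> U)"
    and \<mu>: "reg_cond_law M G borel X \<mu>"
    and a: "reg_cond_law_at M G X (restrict_space borel U) \<alpha> a"
  have spG: "space G = space M" using G by (simp add: subalgebra_def)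
  \<comment> \<open>A probability space has a point, and \<open>\<alpha>\<close> maps it into
    \<open>U\<close>; the dense sequence depends on this.\<close>
  have "U \<noteq> {}"
  proof -
    obtain \<omega> where "\<omega> \<in> space M" using prob_space.not_empty[OF M] by blast
    then have "(X \<omega>, \<alpha> \<omega>) \<in> space ?W" by (rule measurable_space[OF XA])
    then show ?thesis by (auto simp: space_restrict_space)
  qed
  then obtain s :: "nat \<Rightarrow> (real ^ 'n) \<times> 'b" where s: "range s \<subseteq> UNIV \<times> U"
    and dense: "\<And>w e. w \<in> UNIV \<times> U \<Longrightarrow> e > 0 \<Longrightarrow> \<exists>i. dist w (s i) < e"
    using countable_dense_UNIV_Times_compact[OF U] by blast
  obtain E where E: "countable E" "Int_stable E" "E \<subseteq> Pow (UNIV \<times> U)" "UNIV \<times> U \<in> E"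
      "sets ?W = sigma_sets (UNIV \<times> U) E"
    using countable_generator_restrict_borel[OF s dense] by metis
  \<comment> \<open>The first components of \<open>s\<close> are dense in R^n and yield a second
    countable pi-system, for laws on R^n.\<close>
  have dense_fst: "\<exists>i. dist w ((fst \<circ> s) i) < e" if e: "e > 0" for w e
  proof -
    obtain u where "u \<in> U" using \<open>U \<noteq> {}\<close> by blast
    then obtain i where "dist (w, u) (s i) < e" using dense[of "(w, u)" e] e by auto
    then show ?thesis using dist_fst_le[of "(w, u)" "s i"] by (auto intro!: exI[of _ i])
  qed
  obtain F :: "(real ^ 'n) set set" where F: "countable F" "Int_stable F" "F \<subseteq> Pow UNIV" "UNIV \<in> F"
      "sets (restrict_space borel UNIV) = sigma_sets UNIV F"
    using countable_generator_restrict_borel[of "fst \<circ> s" UNIV] dense_fst by auto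
  define g where "g = (\<lambda>p. fst (snd p) + \<gamma> (fst (snd p)) (\<rho> (fst p)) (snd (snd p)) z)"
  have g: "g \<in> borel_measurable (G \<Otimes>\<^sub>M ?W)"
  proof -
    have "(\<lambda>p. \<gamma> (fst (snd p)) (\<rho> (fst p)) (snd (snd p)) z) \<in> borel_measurable (G \<Otimes>\<^sub>M ?W)"
    \<comment> \<open>Measurability is claimed at every point, so \<open>\<rho> \<omega>\<close>
      must lie in \<open>P2\<close> everywhere and not just almost surely: the bounds on
      \<open>\<gamma>\<close> are given only there.\<close>
    proof (rule measurable_FM_Lipschitz[OF s dense, where L=L and h="\<lambda>\<pi> w. \<gamma> (fst w) \<pi> (snd w) z"])
      show "\<rho> \<in> G \<rightarrow>\<^sub>M prob_algebra ?W" using \<rho> by (simp add: reg_cond_law_def)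
      show "\<rho> \<omega> \<in> P2 (UNIV \<times> U)" if "\<omega> \<in> space G" for \<omega> using that \<rho>P2 spG by simp
      show "(\<lambda>w. \<gamma> (fst w) \<pi> (snd w) z) \<in> borel_measurable ?W" if "\<pi> \<in> P2 (UNIV \<times> U)" for \<pi>
        by (rule gamma_W[OF that z])
      show "norm (\<gamma> (fst w) \<pi> (snd w) z - \<gamma> (fst w) \<pi>' (snd w) z) \<le> L * FM_dist U \<pi> \<pi>'"
        if "\<pi> \<in> P2 (UNIV \<times> U)" "\<pi>' \<in> P2 (UNIV \<times> U)" "w \<in> space ?W" for \<pi> \<pi>' w
      proof -
        have "snd w \<in> U" using that(3) by (auto simp: space_restrict_space)
        from gamma_Lip[OF that(2,1) this z, of "fst w" "fst w"] show ?thesis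
          by (simp add: Metric_space.commute[OF Metric_space_FM_dist, of _ \<pi> \<pi>'])
      qed
    qed
    then show ?thesis
      unfolding g_def by (intro borel_measurable_add measurable_compose[OF measurable_snd fst_W])
  qed
  \<comment> \<open>This version settles existence; an arbitrary version \<open>\<kappa>\<close> is
    compared with it by uniqueness.\<close>
  have law: "reg_cond_law M G borel (\<lambda>\<omega>. X \<omega> + \<gamma> (X \<omega>) (\<rho> \<omega>) (\<alpha> \<omega>) z)
      (\<lambda>\<omega>. distr (\<rho> \<omega>) borel (\<lambda>w. g (\<omega>, w)))"
    using reg_cond_law_distr[OF M G \<rho> g] by (simp add: g_def)
  have "AE \<omega> in M. I_adj \<gamma> U (\<mu> \<omega>) (a \<omega>) z (\<mu> \<omega>) = \<kappa> \<omega>"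
    if \<kappa>: "reg_cond_law M G borel (\<lambda>\<omega>. X \<omega> + \<gamma> (X \<omega>) (\<rho> \<omega>) (\<alpha> \<omega>) z) \<kappa>" for \<kappa>
  proof -
    have "AE \<omega> in M. kernel_prod U (\<mu> \<omega>) (a \<omega>) = \<rho> \<omega>"
      by (rule reg_cond_law_unique[OF M G reg_cond_law_kernel_prod[OF M G XA \<mu> a] \<rho> E])
    moreover have "AE \<omega> in M. distr (\<rho> \<omega>) borel (\<lambda>w. g (\<omega>, w)) = \<kappa> \<omega>"
      by (rule reg_cond_law_unique[OF M G law \<kappa> F(1-4)]) (use F(5) in simp)
    ultimately show ?thesis
      using AE_space
    proof eventually_elim
      case (elim \<omega>)
      have \<omega>: "\<omega> \<in> space G" using elim(3) spG by simp
      have "a \<omega> \<in> kernels U"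
        using a measurable_compose[OF measurable_Pair1'[OF \<omega>], of "\<lambda>(\<omega>, x). a \<omega> x"]
        by (auto simp: kernels_def reg_cond_law_at_def)
      moreover have "\<mu> \<omega> \<in> space (prob_algebra borel)"
        using \<mu> measurable_space[OF _ \<omega>] by (auto simp: reg_cond_law_def)
      moreover have "kernel_prod U (\<mu> \<omega>) (a \<omega>) \<in> P2 (UNIV \<times> U)" using elim(1,3) \<rho>P2 by simp
      ultimately have "I_adj \<gamma> U (\<mu> \<omega>) (a \<omega>) z (\<mu> \<omega>) = distr (\<rho> \<omega>) borel (\<lambda>w. g (\<omega>, w))"
        using I_adj z elim(1) by (simp add: g_def)
      then show ?case using elim(2) by simp
    qed
  qed
  then show "let Y = (\<lambda>\<omega>. X \<omega> + \<gamma> (X \<omega>) (\<rho> \<omega>) (\<alpha> \<omega>) z) in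
      (\<exists>\<kappa>. reg_cond_law M G borel Y \<kappa>) \<and>
      (\<forall>\<kappa>. reg_cond_law M G borel Y \<kappa> \<longrightarrow>
        (AE \<omega> in M. I_adj \<gamma> U (\<mu> \<omega>) (a \<omega>) z (\<mu> \<omega>) = \<kappa> \<omega>))"
    using law unfolding Let_def by blast
qed

end
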